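(* Let $d\geq 2$. If $\beta<\frac{3-d}{4}$, then for any $A>0$ there exists $f\in\dot{H}^{\frac{d-1}{4}+\beta}(\mathbb{R}^d)$ such that \[ \frac{\left\||\square|^\beta|e^{itD}f|^2\right\|_{L^2(\mathbb{R}^{d+1})}}{\|f\|_{\dot{H}^{\frac{d-1}{4}+\beta}(\mathbb{R}^d)}^2}>A . \]
   Context: Spatial Fourier transform on $\mathbb{R}^d$: $\widehat{f}(\xi)=\int_{\mathbb{R}^d}e^{-ix\cdot\xi}f(x)\,\mathrm{d}x$. Space-time Fourier transform on $\mathbb{R}\times\mathbb{R}^d$: $\widetilde{u}(\tau,\xi)=\int_{\mathbb{R}^{d+1}}e^{-it\tau-ix\cdot\xi}u(t,x)\,\mathrm{d}x\,\mathrm{d}t$. $D=\sqrt{-\Delta_x}$, and the half-wave propagator is $e^{itD}f(x)=\frac{1}{(2\pi)^d}\int_{\mathbb{R}^d}e^{ix\cdot\xi}e^{it|\xi|}\widehat{f}(\xi)\,\mathrm{d}\xi$ for $(t,x)\in\mathbb{R}\times\mathbb{R}^d$ (defined first on Schwartz functions). $|\square|^\beta$ is the space-time Fourier multiplier $\widetilde{|\square|^\beta u}(\tau,\xi)=|\tau^2-|\xi|^2|^{\beta}\,\widetilde{u}(\tau,\xi)$; the $L^2(\mathbb{R}^{d+1})$ norm of $|\square|^\beta u$ is understood through Plancherel's theorem as an element of $[0,\infty]$. Homogeneous Sobolev norm: $\|f\|_{\dot{H}^s(\mathbb{R}^d)}=\|D^sf\|_{L^2(\mathbb{R}^d)}$,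 i.e. $\|f\|_{\dot{H}^s}^2=(2\pi)^{-d}\int_{\mathbb{R}^d}|\xi|^{2s}|\widehat{f}(\xi)|^2\,\mathrm{d}\xi$. *)

theory Defs
  imports "HOL-Analysis.Analysis"
begin

section \<open>Schwartz functions\<close>

primrec iter_dderiv :: "'a::euclidean_space list \<Rightarrow> ('a \<Rightarrow> complex) \<Rightarrow> 'a \<Rightarrow> complex" where
  "iter_dderiv [] \<phi> = \<phi>"
| "iter_dderiv (v # vs) \<phi> = (\<lambda>x. frechet_derivative (iter_dderiv vs \<phi>) (at x) v)"

definition schwartz :: "('a::euclidean_space \<Rightarrow> complex) \<Rightarrow> bool" where
  "schwartz \<phi> \<longleftrightarrow>
     (\<forall>vs. set vs \<subseteq> Basis \<longrightarrow>
        (\<forall>x. iter_dderiv vs \<phi> differentiable at x) \<and>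
        (\<forall>k::nat. bounded (range (\<lambda>x. (norm x) ^ k *\<^sub>R iter_dderiv vs \<phi> x))))"


section \<open>The Fourier transform\<close>

definition fourier_int :: "('a::euclidean_space \<Rightarrow> complex) \<Rightarrow> 'a \<Rightarrow> complex" where
  "fourier_int f \<xi> = (LINT x|lborel. cis (- (x \<bullet> \<xi>)) * f x)"

text \<open>Measurable functions of polynomial growth in the mean; each of them defines a tempered
  distribution by integration.\<close>

definition tempered :: "('a::euclidean_space \<Rightarrow> complex) \<Rightarrow> bool" where
  "tempered f \<longleftrightarrow> f \<in> borel_measurable borel \<and>
     (\<exists>N::nat. integrable lborel (\<lambda>x. f x / of_real ((1 + norm x) ^ N)))"

text \<open>The function \<open>F\<close> is the Fourier transform of \<open>f\<close> in the sense of tempered distributions;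
  \<open>F\<close> is then unique up to null sets.\<close>

definition has_fourier ::
    "('a::euclidean_space \<Rightarrow> complex) \<Rightarrow> ('a \<Rightarrow> complex) \<Rightarrow> bool" where
  "has_fourier f F \<longleftrightarrow> tempered f \<and> tempered F \<and>
     (\<forall>\<phi>. schwartz \<phi> \<longrightarrow>
        (LINT x|lborel. f x * fourier_int \<phi> x) = (LINT \<xi>|lborel. F \<xi> * \<phi> \<xi>))"

text \<open>The integral formula where it converges absolutely, and its extension to tempered
  distributions otherwise. The extension is essential on space-time, because the squared modulus of
  a half-wave is never integrable over \<open>\<real> \<times> \<real>\<^sup>d\<close> unless it vanishes. If the Fourier transform is
  not a function, the value is an unspecified function.\<close>

definition fourier :: "('a::euclidean_space \<Rightarrow> complex) \<Rightarrow> 'a \<Rightarrow> complex" where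
  "fourier f = (if integrable lborel f then fourier_int f else (SOME F. has_fourier f F))"


section \<open>Norms and the half-wave propagator\<close>

definition esqrt :: "ennreal \<Rightarrow> ennreal" where
  "esqrt a = (if a = top then top else ennreal (sqrt (enn2real a)))"

definition Hdot_norm :: "real \<Rightarrow> ('a::euclidean_space \<Rightarrow> complex) \<Rightarrow> ennreal" where
  "Hdot_norm s f =
     esqrt (ennreal ((2 * pi) powr - real DIM('a)) *
       (\<integral>\<^sup>+ \<xi>. ennreal (norm \<xi> powr (2 * s) * (cmod (fourier f \<xi>))\<^sup>2) \<partial>lborel))"

definition Hdot :: "real \<Rightarrow> ('a::euclidean_space \<Rightarrow> complex) set" where
  "Hdot s = {f. has_fourier f (fourier f) \<and> Hdot_norm s f < top}"

text \<open>The first branch is the integral formula for the propagator. When the integral does not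
  converge absolutely, \<open>exp(itD) f\<close> is the jointly measurable function (unique up to null sets)
  whose spatial Fourier transform at each time \<open>t\<close> is \<open>exp(it|\<xi>|)\<close> times that of \<open>f\<close>.\<close>

definition halfwave :: "('a::euclidean_space \<Rightarrow> complex) \<Rightarrow> real \<times> 'a \<Rightarrow> complex" where
  "halfwave f =
     (if integrable lborel (fourier f)
      then (\<lambda>(t, x). of_real ((2 * pi) powr - real DIM('a)) *
              (LINT \<xi>|lborel. cis (x \<bullet> \<xi>) * cis (t * norm \<xi>) * fourier f \<xi>))
      else (SOME u. u \<in> borel_measurable borel \<and>
              (\<forall>t. has_fourier (\<lambda>x. u (t, x)) (\<lambda>\<xi>. cis (t * norm \<xi>) * fourier f \<xi>))))"

text \<open>The \<open>L\<^sup>2\<close> norm of \<open>|\<box>|\<^sup>\<beta> w\<close> on \<open>\<real> \<times> \<real>\<^sup>d\<close>, by Plancherel. The value of the multiplier on the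
  light cone (where \<open>0 powr \<beta> = 0\<close>) is immaterial, since the cone is a null set.\<close>

definition box_power_norm :: "real \<Rightarrow> (real \<times> 'a::euclidean_space \<Rightarrow> complex) \<Rightarrow> ennreal" where
  "box_power_norm \<beta> w =
     esqrt (ennreal ((2 * pi) powr - (real DIM('a) + 1)) *
       (\<integral>\<^sup>+ (\<tau>, \<xi>). ennreal ((\<bar>\<tau>\<^sup>2 - (norm \<xi>)\<^sup>2\<bar> powr \<beta> * cmod (fourier w (\<tau>, \<xi>)))\<^sup>2) \<partial>lborel))"

end

theory Submission
  imports Defs "HOL-Probability.Probability"
begin

text \<open>The example is a Knapp plate. Let \<open>\<epsilon>\<close> be small and let the Fourier transform of \<open>f\<close> be the
  indicator of the plate \<open>P\<close> on which \<open>1 \<le> \<eta>\<^sub>k \<le> 2\<close> and all other coordinates lie in \<open>[0, 4\<epsilon>]\<close>. The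
  space-time Fourier transform of \<open>|exp(itD) f|\<^sup>2\<close> is, up to a constant, the density of the image of
  Lebesgue measure on \<open>P \<times> P\<close> under \<open>(\<eta>, \<zeta>) \<mapsto> (|\<eta>| - |\<zeta>|, \<eta> - \<zeta>)\<close>; since
  \<open>|\<xi>|\<^sup>2 - \<tau>\<^sup>2 = 2(|\<eta>||\<zeta>| - \<eta> \<bullet> \<zeta>)\<close> on the image, a fixed proportion of its mass \<open>\<epsilon>\<^bsup>2(d-1)\<^esup>\<close> lies
  in a region of volume \<open>\<epsilon>\<^bsup>d+1\<^esup>\<close> in which \<open>|\<tau>\<^sup>2 - |\<xi>|\<^sup>2|\<close> is comparable to \<open>\<epsilon>\<^sup>2\<close>. Cauchy-Schwarz on that
  region bounds the quotient below by a constant times \<open>\<epsilon>\<^bsup>2\<beta> + (d-3)/2\<^esup>\<close>, which is unbounded. The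
  density itself is never computed: absolute continuity and Radon-Nikodym suffice.\<close>

section \<open>Integration on Euclidean spaces\<close>

text \<open>Power count with m = d - 1 and e for the small parameter: Cauchy-Schwarz bounds
  (e^(2m))^2 by the squared box norm times e^(-4 beta) e^(m+2). The squared Sobolev norm is of order
  e^m, since frequencies on the plate have size between 1 and 5/2 and the Sobolev weight affects
  only constants. The squared quotient is thus at least of order e^(m-2+4 beta), and this exponent
  is negative exactly when beta < (3-d)/4. The volume is e^(d+1) because |eta| exceeds eta_k only by
  O(e^2), which confines tau - xi_k to size e^2. A null form of size e^2 needs pairs at an angle of
  order e; the transverse ranges [0,e] and [3e,4e] supply them. The shape of the development comes
  from \<open>fourier\<close> being a choice on non-integrable functions. A statement about it needs
  a candidate satisfying \<open>has_fourier\<close>, obtained from Fourier inversion for Schwartz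
  functions, and uniqueness up to null sets. The candidate must be a function, hence the absolute
  continuity; in dimension one it fails, as pairs of positive numbers are mapped into a
  line.\<close>

lemma lborel_prod_Basis:
  fixes h :: "'a::euclidean_space \<Rightarrow> real \<Rightarrow> complex"
  assumes "\<And>b. b \<in> Basis \<Longrightarrow> integrable lborel (h b)"
  shows lborel_integrable_prod_Basis: "integrable lborel (\<lambda>x::'a. \<Prod>b\<in>Basis. h b (x \<bullet> b))"
    and lborel_integral_prod_Basis:
      "(LINT x|lborel. (\<Prod>b\<in>(Basis::'a set). h b (x \<bullet> b))) = (\<Prod>b\<in>Basis. (LINT s|lborel. h b s))"
proof -
  interpret product_sigma_finite "\<lambda>_::'a. lborel :: real measure" ..
  have [measurable]: "h b \<in> borel_measurable borel" if "b \<in> Basis" for b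
    using assms[OF that] by auto
  have [measurable]: "(\<lambda>f. \<Sum>b\<in>Basis. f b *\<^sub>R b) \<in> Pi\<^sub>M Basis (\<lambda>_. lborel) \<rightarrow>\<^sub>M (borel :: 'a measure)"
    by measurable
  have [measurable]: "(\<lambda>x::'a. \<Prod>b\<in>Basis. h b (x \<bullet> b)) \<in> borel_measurable borel"
    by measurable
  have eq: "(\<Prod>b\<in>Basis. h b ((\<Sum>c\<in>Basis. f c *\<^sub>R c) \<bullet> b)) = (\<Prod>b\<in>Basis. h b (f b))"
    for f :: "'a \<Rightarrow> real"
    by (intro prod.cong) auto
  show "integrable lborel (\<lambda>x::'a. \<Prod>b\<in>Basis. h b (x \<bullet> b))"
    by (subst lborel_eq, subst integrable_distr_eq)
       (auto simp: eq intro!: product_integrable_prod assms)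
  show "(LINT x|lborel. (\<Prod>b\<in>(Basis::'a set). h b (x \<bullet> b))) = (\<Prod>b\<in>Basis. (LINT s|lborel. h b s))"
    by (subst lborel_eq, subst integral_distr)
       (auto simp: eq intro!: product_integral_prod assms)
qed

lemma integrable_inverse_1_plus_square_lborel:
  "integrable lborel (\<lambda>s::real. 1 / (1 + s\<^sup>2))"
  using integrable_inverse_1_plus_square
  by (simp add: set_integrable_def einterval_def divide_inverse)

text \<open>Each factor satisfies 1 + x_b^2 <= (1 + |x|)^2, so a product of one-dimensional weights
  is a majorant. The exponent is not sharp; some fixed exponent is all that is used later.\<close>

lemma integrable_inverse_norm_power:
  "integrable lborel (\<lambda>x::'a::euclidean_space. 1 / (1 + norm x) ^ (2 * DIM('a)))"
proof -
  have "integrable lborel (\<lambda>s::real. complex_of_real (1 / (1 + s\<^sup>2)))"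
    using integrable_inverse_1_plus_square_lborel by (rule integrable_of_real)
  then have "integrable lborel (\<lambda>x::'a. \<Prod>b\<in>Basis. complex_of_real (1 / (1 + (x \<bullet> b)\<^sup>2)))"
    by (rule lborel_integrable_prod_Basis)
  then have *: "integrable lborel (\<lambda>x::'a. norm (\<Prod>b\<in>Basis. complex_of_real (1 / (1 + (x \<bullet> b)\<^sup>2))))"
    by (rule integrable_norm)
  show ?thesis
  proof (rule Bochner_Integration.integrable_bound[OF *])
    have "1 / (1 + norm x) ^ (2 * DIM('a)) \<le> (\<Prod>b\<in>Basis. 1 / (1 + (x \<bullet> b)\<^sup>2))" for x :: 'a
    proof -
      have "(\<Prod>b\<in>Basis. 1 + (x \<bullet> b)\<^sup>2) \<le> (\<Prod>b\<in>(Basis::'a set). (1 + norm x)\<^sup>2)"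
      proof (intro prod_mono conjI)
        fix b :: 'a assume "b \<in> Basis"
        then have "\<bar>x \<bullet> b\<bar> \<le> norm x" by (rule Basis_le_norm)
        then have "(x \<bullet> b)\<^sup>2 \<le> (norm x)\<^sup>2"
          by (metis abs_norm_cancel abs_le_square_iff)
        then show "1 + (x \<bullet> b)\<^sup>2 \<le> (1 + norm x)\<^sup>2"
          by (simp add: power2_sum add_increasing2)
      qed simp
      also have "\<dots> = (1 + norm x) ^ (2 * DIM('a))"
        by (simp add: power_mult)
      finally have le: "(\<Prod>b\<in>Basis. 1 + (x \<bullet> b)\<^sup>2) \<le> (1 + norm x) ^ (2 * DIM('a))" .
      have pos: "0 < (\<Prod>b\<in>Basis. 1 + (x \<bullet> b)\<^sup>2)"
        by (intro prod_pos) (simp add: add_pos_nonneg)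
      show ?thesis
        using le pos by (simp add: prod_dividef frac_le)
    qed
    then show "AE x in lborel. norm (1 / (1 + norm (x::'a)) ^ (2 * DIM('a)))
        \<le> norm (norm (\<Prod>b\<in>Basis. complex_of_real (1 / (1 + (x \<bullet> b)\<^sup>2))))"
      by (intro AE_I2) (simp add: prod_norm[symmetric] norm_divide abs_prod del: of_real_divide of_real_add)
  qed measurable
qed

lemma one_plus_norm_power_le: "(1 + t) ^ N \<le> 2 ^ N * (1 + t ^ N)" if "t \<ge> 0" for t :: real
proof (cases "t \<le> 1")
  case True
  then have "(1 + t) ^ N \<le> 2 ^ N" using that by (intro power_mono) auto
  then show ?thesis using that by (simp add: distrib_left)
      (metis add_increasing2 mult_nonneg_nonneg zero_le_numeral zero_le_power)
next
  case False
  then have "(1 + t) ^ N \<le> (2 * t) ^ N" using that by (intro power_mono) auto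
  then show ?thesis by (simp add: power_mult_distrib distrib_left add_increasing)
qed

text \<open>The decay half of \<open>schwartz\<close>. It is kept separate because it is also
  applied to \<open>fourier_int \<phi>\<close>, whose smoothness is never established, and to
  indicators of bounded sets, which are not smooth.\<close>

definition rapid :: "('a::euclidean_space \<Rightarrow> complex) \<Rightarrow> bool" where
  "rapid g \<longleftrightarrow> (\<forall>k::nat. bounded (range (\<lambda>x. norm x ^ k *\<^sub>R g x)))"

lemma rapid_bound:
  assumes "rapid g"
  obtains C where "C > 0" "\<And>x. cmod (g x) \<le> C / (1 + norm x) ^ N"
proof -
  have "bounded (range (\<lambda>x. norm x ^ 0 *\<^sub>R g x))" "bounded (range (\<lambda>x. norm x ^ N *\<^sub>R g x))"
    using assms unfolding rapid_def by blast+
  then obtain B0 B1 where B: "\<And>x. cmod (g x) \<le> B0" "\<And>x. norm x ^ N * cmod (g x) \<le> B1"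
    by (auto simp: bounded_iff)
  define C where "C = 2 ^ N * (B0 + B1) + 1"
  have "B0 \<ge> 0" "B1 \<ge> 0"
    using B(1)[of 0] order_trans[OF norm_ge_zero] apply blast
    using B(2)[of 0] by (meson order_trans mult_nonneg_nonneg norm_ge_zero zero_le_power)
  then have "C > 0"
    unfolding C_def by (smt (verit) mult_nonneg_nonneg zero_le_power)
  moreover have "cmod (g x) \<le> C / (1 + norm x) ^ N" for x
  proof -
    have "(1 + norm x) ^ N * cmod (g x) \<le> 2 ^ N * (1 + norm x ^ N) * cmod (g x)"
      by (intro mult_right_mono one_plus_norm_power_le) auto
    also have "\<dots> = 2 ^ N * (cmod (g x) + norm x ^ N * cmod (g x))"
      by (simp add: algebra_simps)
    also have "\<dots> \<le> 2 ^ N * (B0 + B1)"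
      using B[of x] by (intro mult_left_mono add_mono) auto
    also have "\<dots> \<le> C" by (simp add: C_def)
    finally show ?thesis
      by (simp add: pos_le_divide_eq add_pos_nonneg mult.commute)
  qed
  ultimately show ?thesis using that by blast
qed

lemma rapid_integrable:
  fixes g :: "'a::euclidean_space \<Rightarrow> complex"
  assumes "rapid g" "g \<in> borel_measurable borel"
  shows "integrable lborel g"
proof -
  obtain C where C: "C > 0" "\<And>x. cmod (g x) \<le> C / (1 + norm x) ^ (2 * DIM('a))"
    using rapid_bound[OF assms(1), of "2 * DIM('a)"] by blast
  have "integrable lborel (\<lambda>x::'a. C * (1 / (1 + norm x) ^ (2 * DIM('a))))"
    by (intro integrable_mult_right integrable_inverse_norm_power)
  then show ?thesis
  proof (rule Bochner_Integration.integrable_bound)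
    show "AE x in lborel. cmod (g x) \<le> norm (C * (1 / (1 + norm x) ^ (2 * DIM('a))))"
    proof (intro AE_I2 order_trans[OF C(2)])
      fix x :: 'a
      show "C / (1 + norm x) ^ (2 * DIM('a)) \<le> norm (C * (1 / (1 + norm x) ^ (2 * DIM('a))))"
        using abs_ge_self[of "C * (1 / (1 + norm x) ^ (2 * DIM('a)))"] by (simp only: real_norm_def) simp
    qed
  qed (use assms in simp)
qed

lemma lborel_integral_affine:
  fixes f :: "'a::euclidean_space \<Rightarrow> complex"
  assumes "c \<noteq> 0" and [measurable]: "f \<in> borel_measurable borel"
  shows "(LINT x|lborel. f x) = \<bar>c\<bar> ^ DIM('a) *\<^sub>R (LINT x|lborel. f (t + c *\<^sub>R x))"
    and "integrable lborel f \<Longrightarrow> integrable lborel (\<lambda>x. f (t + c *\<^sub>R x))"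
proof -
  have [measurable]: "(\<lambda>x. t + c *\<^sub>R x) \<in> (borel :: 'a measure) \<rightarrow>\<^sub>M borel" by simp
  show "(LINT x|lborel. f x) = \<bar>c\<bar> ^ DIM('a) *\<^sub>R (LINT x|lborel. f (t + c *\<^sub>R x))"
    by (subst lborel_affine[OF assms(1), of t], subst integral_density)
       (auto simp: integral_distr)
  assume "integrable lborel f"
  then have "integrable lborel (\<lambda>x. \<bar>c\<bar> ^ DIM('a) *\<^sub>R f (t + c *\<^sub>R x))"
    by (subst (asm) lborel_affine[OF assms(1), of t], subst (asm) integrable_density)
       (auto simp: integrable_distr_eq)
  then have "integrable lborel (\<lambda>x. inverse (\<bar>c\<bar> ^ DIM('a)) *\<^sub>R \<bar>c\<bar> ^ DIM('a) *\<^sub>R f (t + c *\<^sub>R x))"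
    by (rule integrable_scaleR_right)
  then show "integrable lborel (\<lambda>x. f (t + c *\<^sub>R x))"
    using assms(1) by simp
qed

section \<open>Schwartz functions\<close>

lemma iter_dderiv_append: "iter_dderiv (vs @ ws) \<phi> = iter_dderiv vs (iter_dderiv ws \<phi>)"
  by (induction vs) simp_all

lemma schwartz_iter_dderiv:
  assumes "schwartz \<phi>" "set ws \<subseteq> Basis"
  shows "schwartz (iter_dderiv ws \<phi>)"
  unfolding schwartz_def
proof (intro allI impI)
  fix vs :: "'a list" assume vs: "set vs \<subseteq> Basis"
  then have "set (vs @ ws) \<subseteq> Basis" using assms(2) by auto
  then show "(\<forall>x. iter_dderiv vs (iter_dderiv ws \<phi>) differentiable at x) \<and>
        (\<forall>k::nat. bounded (range (\<lambda>x. (norm x) ^ k *\<^sub>R iter_dderiv vs (iter_dderiv ws \<phi>) x)))"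
    using assms(1) unfolding schwartz_def iter_dderiv_append[symmetric] by blast
qed

lemma schwartz_differentiable: "schwartz \<phi> \<Longrightarrow> \<phi> differentiable at x"
  unfolding schwartz_def by (metis iter_dderiv.simps(1) empty_set empty_subsetI)

lemma schwartz_rapid: "schwartz \<phi> \<Longrightarrow> rapid \<phi>"
  unfolding schwartz_def rapid_def by (metis iter_dderiv.simps(1) empty_set empty_subsetI)

lemma schwartz_continuous: "schwartz \<phi> \<Longrightarrow> continuous_on UNIV \<phi>"
  by (meson continuous_at_imp_continuous_on differentiable_imp_continuous_within schwartz_differentiable)

lemma schwartz_measurable: "schwartz \<phi> \<Longrightarrow> \<phi> \<in> borel_measurable borel"
  by (intro borel_measurable_continuous_onI schwartz_continuous)

lemma schwartz_integrable: "schwartz \<phi> \<Longrightarrow> integrable lborel \<phi>"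
  by (intro rapid_integrable schwartz_rapid schwartz_measurable)

section \<open>Fourier inversion for Schwartz functions\<close>

text \<open>Difference quotients along 1/(k+1) rather than a real parameter, to match dominated
  convergence for sequences.\<close>

lemma has_vector_derivative_imp_LIMSEQ:
  fixes g :: "real \<Rightarrow> complex"
  assumes "(g has_vector_derivative D) (at 0)"
  shows "(\<lambda>k. (g (1 / Suc k) - g 0) /\<^sub>R (1 / Suc k)) \<longlonglongrightarrow> D"
proof -
  have "((\<lambda>h. norm ((g (0 + h) - g 0 - h *\<^sub>R D) /\<^sub>R norm h)) \<longlongrightarrow> 0) (at 0)"
    using assms unfolding has_vector_derivative_def has_derivative_at by (simp add: divide_inverse mult.commute)
  then have "((\<lambda>h. (g (0 + h) - g 0 - h *\<^sub>R D) /\<^sub>R norm h) \<longlongrightarrow> 0) (at 0)"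
    by (rule tendsto_norm_zero_cancel)
  moreover have "filterlim (\<lambda>k. 1 / real (Suc k)) (at 0) sequentially"
    unfolding filterlim_at
    using LIMSEQ_inverse_real_of_nat by (auto simp: inverse_eq_divide)
  ultimately have "(\<lambda>k. (g (0 + 1 / Suc k) - g 0 - (1 / Suc k) *\<^sub>R D) /\<^sub>R norm (1 / real (Suc k))) \<longlonglongrightarrow> 0"
    by (rule filterlim_compose)
  then have "(\<lambda>k. (g (1 / Suc k) - g 0) /\<^sub>R (1 / Suc k) - D) \<longlonglongrightarrow> 0"
    by (simp add: algebra_simps scaleR_diff_right divide_simps del: of_nat_Suc)
  then show ?thesis by (simp add: LIM_zero_iff)
qed

lemma measurable_cis[measurable]: "cis \<in> borel_measurable borel"
  by (intro borel_measurable_continuous_onI) (intro continuous_intros)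

lemma cis_integrable:
  assumes "integrable M g" and [measurable]: "a \<in> borel_measurable M"
  shows "integrable M (\<lambda>x. cis (a x) * g x)"
proof (rule Bochner_Integration.integrable_bound[OF assms(1)])
  show "(\<lambda>x. cis (a x) * g x) \<in> borel_measurable M"
    using assms by measurable
qed (simp add: norm_mult)

lemma schwartz_line_derivative:
  assumes "schwartz \<phi>"
  shows "((\<lambda>s. \<phi> (x + s *\<^sub>R b)) has_vector_derivative iter_dderiv [b] \<phi> (x + s *\<^sub>R b)) (at s)"
proof -
  have "(\<phi> has_derivative frechet_derivative \<phi> (at (x + s *\<^sub>R b))) (at (x + s *\<^sub>R b))"
    using schwartz_differentiable[OF assms] frechet_derivative_works by blast
  moreover have "((\<lambda>s. x + s *\<^sub>R b) has_vector_derivative b) (at s)"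
    by (auto intro!: derivative_eq_intros)
  ultimately have "(\<phi> \<circ> (\<lambda>s. x + s *\<^sub>R b) has_vector_derivative
      frechet_derivative \<phi> (at (x + s *\<^sub>R b)) b) (at s)"
    using vector_derivative_diff_chain_within[of "\<lambda>s. x + s *\<^sub>R b" b s UNIV \<phi>] has_derivative_at_withinI by blast
  then show ?thesis by (simp add: o_def)
qed

text \<open>Moving by at most 1 changes 1 + |x| by at most a factor 2. One majorant in x thereby
  controls a derivative on a whole unit segment starting at x.\<close>

lemma rapid_neighbour_bound:
  assumes "0 \<le> C" "norm (y - x) \<le> 1"
  shows "C / (1 + norm y) ^ N \<le> C * 2 ^ N / (1 + norm x) ^ N"
proof -
  have "norm x \<le> 1 + norm y"
    using assms(2) norm_triangle_ineq2[of x y] by (simp add: norm_minus_commute)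
  then have "(1 + norm x) ^ N \<le> (2 * (1 + norm y)) ^ N"
    using order_trans[of "norm x" "1 + norm y" "1 + 2 * norm y"]
    by (intro power_mono) (simp_all add: add_nonneg_nonneg)
  then have "(1 + norm x) ^ N \<le> 2 ^ N * (1 + norm y) ^ N" by (simp only: power_mult_distrib)
  then have "C * (1 + norm x) ^ N \<le> C * (2 ^ N * (1 + norm y) ^ N)"
    using assms(1) by (rule mult_left_mono)
  then show ?thesis
    by (simp add: frac_le_eq divide_simps add_pos_nonneg zero_less_power mult_ac)
qed

text \<open>Integration by parts is replaced by translation invariance: the transform of a
  difference quotient of \<open>\<phi>\<close> is
  \<open>(cis (h * (\<xi> \<bullet> b)) - 1) / h\<close> times that of \<open>\<phi>\<close>. As h
  tends to 0, dominated convergence gives one side and the derivative of \<open>cis\<close> at 0 the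
  other.\<close>

lemma fourier_int_dderiv:
  fixes \<phi> :: "'a::euclidean_space \<Rightarrow> complex"
  assumes \<phi>: "schwartz \<phi>" and b: "b \<in> Basis"
  shows "fourier_int (iter_dderiv [b] \<phi>) \<xi> = \<i> * of_real (\<xi> \<bullet> b) * fourier_int \<phi> \<xi>"
proof -
  define h where "h k = 1 / real (Suc k)" for k
  have h: "h k > 0" "h k \<le> 1" for k by (auto simp: h_def)
  let ?D = "iter_dderiv [b] \<phi>"
  have D: "schwartz ?D" using schwartz_iter_dderiv[OF \<phi>, of "[b]"] b by simp
  have [measurable]: "\<phi> \<in> borel_measurable borel" "?D \<in> borel_measurable borel"
    using schwartz_measurable \<phi> D by auto
  let ?N = "2 * DIM('a)"
  obtain C where C: "C > 0" "\<And>x. cmod (?D x) \<le> C / (1 + norm x) ^ ?N"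
    using rapid_bound[OF schwartz_rapid[OF D], of ?N] by blast
  define s where "s k x = cis (- (x \<bullet> \<xi>)) * ((\<phi> (x + h k *\<^sub>R b) - \<phi> x) /\<^sub>R h k)" for k x
  have "(\<lambda>k. LINT x|lborel. s k x) \<longlonglongrightarrow> (LINT x|lborel. cis (- (x \<bullet> \<xi>)) * ?D x)"
  proof (rule integral_dominated_convergence)
    show "integrable lborel (\<lambda>x::'a. C * 2 ^ ?N * (1 / (1 + norm x) ^ ?N))"
      by (intro integrable_mult_right integrable_inverse_norm_power)
    show "AE x in lborel. (\<lambda>k. s k x) \<longlonglongrightarrow> cis (- (x \<bullet> \<xi>)) * ?D x"
    proof (intro AE_I2)
      fix x
      have "(\<lambda>k. (\<phi> (x + (1 / Suc k) *\<^sub>R b) - \<phi> (x + 0 *\<^sub>R b)) /\<^sub>R (1 / Suc k)) \<longlonglongrightarrow> ?D (x + 0 *\<^sub>R b)"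
        by (rule has_vector_derivative_imp_LIMSEQ[OF schwartz_line_derivative[OF \<phi>]])
      then have "(\<lambda>k. (\<phi> (x + h k *\<^sub>R b) - \<phi> x) /\<^sub>R h k) \<longlonglongrightarrow> ?D x"
        by (simp add: h_def del: of_nat_Suc)
      then show "(\<lambda>k. s k x) \<longlonglongrightarrow> cis (- (x \<bullet> \<xi>)) * ?D x"
        unfolding s_def by (intro tendsto_mult tendsto_const)
    qed
    show "AE x in lborel. norm (s k x) \<le> C * 2 ^ ?N * (1 / (1 + norm x) ^ ?N)" for k
    proof (intro AE_I2)
      fix x :: 'a
      define B where "B = C * 2 ^ ?N / (1 + norm x) ^ ?N"
      \<comment> \<open>Mean value inequality on the segment from x to x + h b: the difference
        quotient inherits the bound B of the derivative, uniformly in h.\<close>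
      have "norm (\<phi> (x + h k *\<^sub>R b) - \<phi> (x + 0 *\<^sub>R b)) \<le> B * h k - B * 0"
      proof (rule differentiable_bound_general)
        show "((\<lambda>s. \<phi> (x + s *\<^sub>R b)) has_vector_derivative ?D (x + t *\<^sub>R b)) (at t)" for t
          by (rule schwartz_line_derivative[OF \<phi>])
        then show "continuous_on {0..h k} (\<lambda>s. \<phi> (x + s *\<^sub>R b))"
          by (meson has_vector_derivative_continuous continuous_at_imp_continuous_on)
        show "((\<lambda>s. B * s) has_vector_derivative B) (at t)" for t
          by (auto intro!: derivative_eq_intros simp: has_real_derivative_iff_has_vector_derivative[symmetric])
        show "norm (?D (x + t *\<^sub>R b)) \<le> B" if "0 < t" "t < h k" for t
        proof -
          have "norm (x + t *\<^sub>R b - x) \<le> 1" using b that h(2)[of k] by simp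
          then show ?thesis
            using C rapid_neighbour_bound[of C "x + t *\<^sub>R b" x ?N]
            unfolding B_def by (meson less_imp_le order_trans)
        qed
      qed (use h in \<open>auto intro!: continuous_intros\<close>)
      then have "norm (\<phi> (x + h k *\<^sub>R b) - \<phi> x) / h k \<le> B"
        using h(1)[of k] by (simp add: pos_divide_le_eq)
      then show "norm (s k x) \<le> C * 2 ^ ?N * (1 / (1 + norm x) ^ ?N)"
        using h(1)[of k] by (simp add: s_def B_def norm_mult divide_inverse mult_ac)
    qed
    show "(\<lambda>x. cis (- (x \<bullet> \<xi>)) * ?D x) \<in> borel_measurable lborel" by measurable
    show "s k \<in> borel_measurable lborel" for k unfolding s_def by measurable
  qed
  moreover have "(LINT x|lborel. s k x) = ((cis (h k * (\<xi> \<bullet> b)) - cis (0 * (\<xi> \<bullet> b))) /\<^sub>R h k) * fourier_int \<phi> \<xi>" for k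
  proof -
    have int: "integrable lborel (\<lambda>x. cis (- (x \<bullet> \<xi>)) * \<phi> x)"
      by (intro cis_integrable schwartz_integrable \<phi>) simp
    have int2: "integrable lborel (\<lambda>x. cis (- ((x - h k *\<^sub>R b) \<bullet> \<xi>)) * \<phi> x)"
      by (intro cis_integrable schwartz_integrable \<phi>) simp
    have "(LINT x|lborel. cis (h k * (\<xi> \<bullet> b)) * (cis (- (x \<bullet> \<xi>)) * \<phi> x)) = (LINT x|lborel. cis (- ((x - h k *\<^sub>R b) \<bullet> \<xi>)) * \<phi> x)"
      by (intro Bochner_Integration.integral_cong)
         (simp_all add: mult.assoc[symmetric] cis_mult inner_diff_left inner_commute[of b \<xi>] add.commute)
    also have "\<dots> = (LINT x|lborel. cis (- (x \<bullet> \<xi>)) * \<phi> (x + h k *\<^sub>R b))"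
      by (subst lborel_integral_affine(1)[where t="h k *\<^sub>R b" and c=1]) (auto simp: add.commute)
    finally have tr: "(LINT x|lborel. cis (- (x \<bullet> \<xi>)) * \<phi> (x + h k *\<^sub>R b)) = cis (h k * (\<xi> \<bullet> b)) * fourier_int \<phi> \<xi>"
      using int by (simp add: fourier_int_def)
    have int3: "integrable lborel (\<lambda>x. cis (- (x \<bullet> \<xi>)) * \<phi> (x + h k *\<^sub>R b))"
      using lborel_integral_affine(2)[OF _ _ int2, where t="h k *\<^sub>R b" and c=1] by (simp add: add.commute)
    have "(LINT x|lborel. s k x) = (LINT x|lborel. (cis (- (x \<bullet> \<xi>)) * \<phi> (x + h k *\<^sub>R b) - cis (- (x \<bullet> \<xi>)) * \<phi> x) /\<^sub>R h k)"
      unfolding s_def by (intro Bochner_Integration.integral_cong) (auto simp: algebra_simps)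
    also have "\<dots> = (cis (h k * (\<xi> \<bullet> b)) * fourier_int \<phi> \<xi> - fourier_int \<phi> \<xi>) /\<^sub>R h k"
      using int int3 by (simp add: tr fourier_int_def)
    finally show ?thesis by (simp add: algebra_simps)
  qed
  moreover have "(\<lambda>k. ((cis (h k * (\<xi> \<bullet> b)) - cis (0 * (\<xi> \<bullet> b))) /\<^sub>R h k) * fourier_int \<phi> \<xi>)
      \<longlonglongrightarrow> \<i> * of_real (\<xi> \<bullet> b) * fourier_int \<phi> \<xi>"
  proof -
    have "((\<lambda>s. cis (s * (\<xi> \<bullet> b))) has_vector_derivative \<i> * of_real (\<xi> \<bullet> b)) (at 0)"
      using exp_scaleR_has_vector_derivative_right[of "\<i> * of_real (\<xi> \<bullet> b)" 0 UNIV]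
      by (simp add: cis_conv_exp scaleR_conv_of_real mult_ac)
    from has_vector_derivative_imp_LIMSEQ[OF this] show ?thesis
      by (intro tendsto_mult tendsto_const) (simp add: h_def del: of_nat_Suc)
  qed
  ultimately show ?thesis
    using LIMSEQ_unique by (fastforce simp: fourier_int_def)
qed

lemma integrable_pair_mult:
  fixes f :: "'a \<Rightarrow> complex" and g :: "'b \<Rightarrow> complex"
  assumes M: "sigma_finite_measure M1" "sigma_finite_measure M2"
    and f: "integrable M1 f" and g: "integrable M2 g"
  shows "integrable (M1 \<Otimes>\<^sub>M M2) (\<lambda>(x, y). f x * g y)"
proof -
  interpret M2: sigma_finite_measure M2 by fact
  interpret pair_sigma_finite M1 M2 using M by (simp add: pair_sigma_finite_def)
  have [measurable]: "f \<in> borel_measurable M1" "g \<in> borel_measurable M2" using f g by auto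
  show ?thesis
  proof (rule Fubini_integrable)
    show "integrable M1 (\<lambda>x. LINT y|M2. norm (case (x, y) of (x, y) \<Rightarrow> f x * g y))"
      using f by (simp add: norm_mult)
    show "AE x in M1. integrable M2 (\<lambda>y. case (x, y) of (x, y) \<Rightarrow> f x * g y)"
      using g by simp
  qed measurable
qed

lemma integrable_unimodular:
  fixes f g :: "'a \<Rightarrow> complex"
  assumes "integrable M g" "f \<in> borel_measurable M" "\<And>x. cmod (f x) = cmod (g x)"
  shows "integrable M f"
  by (rule Bochner_Integration.integrable_bound[OF assms(1,2)]) (simp add: assms(3))

lemma fourier_int_measurable[measurable (raw)]:
  fixes f :: "'a::euclidean_space \<Rightarrow> complex"
  assumes [measurable]: "f \<in> borel_measurable borel"
  shows "fourier_int f \<in> borel_measurable borel"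
  unfolding fourier_int_def
proof (rule lborel.borel_measurable_lebesgue_integral)
  show "(\<lambda>(\<xi>, x). cis (- (x \<bullet> \<xi>)) * f x) \<in> borel_measurable (borel \<Otimes>\<^sub>M lborel)"
    by measurable
qed

lemma fourier_int_norm_le: "cmod (fourier_int f \<xi>) \<le> (LINT x|lborel. cmod (f x))"
  unfolding fourier_int_def
  using integral_norm_bound[of lborel "\<lambda>x. cis (- (x \<bullet> \<xi>)) * f x"] by (simp add: norm_mult)

lemma fourier_int_dderiv_replicate:
  assumes \<phi>: "schwartz \<phi>" and b: "b \<in> Basis"
  shows "fourier_int (iter_dderiv (replicate k b) \<phi>) \<xi> = (\<i> * of_real (\<xi> \<bullet> b)) ^ k * fourier_int \<phi> \<xi>"
proof (induction k)
  case (Suc k)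
  have "set (replicate k b) \<subseteq> Basis" using b by (induction k) auto
  then have "schwartz (iter_dderiv (replicate k b) \<phi>)" by (rule schwartz_iter_dderiv[OF \<phi>])
  from fourier_int_dderiv[OF this b, of \<xi>] show ?case
    using Suc by simp
qed simp

text \<open>The k-fold derivative in a single direction b bounds |xi_b|^k times the transform, and
  |xi| is at most the dimension times the largest coordinate, so pure derivatives suffice.\<close>

lemma fourier_int_rapid:
  fixes \<phi> :: "'a::euclidean_space \<Rightarrow> complex"
  assumes \<phi>: "schwartz \<phi>"
  shows "rapid (fourier_int \<phi>)"
  unfolding rapid_def
proof
  fix k
  define B where "B b = (LINT x|lborel. cmod (iter_dderiv (replicate k b) \<phi> x))" for b
  have B0: "B b \<ge> 0" for b unfolding B_def by simp
  have B: "\<bar>\<xi> \<bullet> b\<bar> ^ k * cmod (fourier_int \<phi> \<xi>) \<le> B b" if "b \<in> Basis" for b \<xi>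
    using fourier_int_norm_le[of "iter_dderiv (replicate k b) \<phi>" \<xi>] 
    by (simp add: fourier_int_dderiv_replicate[OF \<phi> that] norm_mult norm_power B_def)
  have "cmod (norm \<xi> ^ k *\<^sub>R fourier_int \<phi> \<xi>) \<le> real DIM('a) ^ k * (\<Sum>b\<in>Basis. B b)" for \<xi>
  proof -
    \<comment> \<open>The direction b of the largest coordinate depends on \<open>\<xi>\<close>;
      summing \<open>B\<close> over the basis at the end removes that dependence.\<close>
    have "Max ((\<lambda>c. \<bar>\<xi> \<bullet> c\<bar>) ` Basis) \<in> (\<lambda>c. \<bar>\<xi> \<bullet> c\<bar>) ` Basis" by (intro Max_in) auto
    then obtain b where b': "b \<in> Basis" "Max ((\<lambda>c. \<bar>\<xi> \<bullet> c\<bar>) ` Basis) = \<bar>\<xi> \<bullet> b\<bar>" by blast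
    then have b: "b \<in> Basis" "\<And>c. c \<in> Basis \<Longrightarrow> \<bar>\<xi> \<bullet> c\<bar> \<le> \<bar>\<xi> \<bullet> b\<bar>"
      using Max_ge[of "(\<lambda>c. \<bar>\<xi> \<bullet> c\<bar>) ` Basis"] by (metis finite_Basis finite_imageI image_eqI)+
    have "norm \<xi> \<le> (\<Sum>c\<in>Basis. \<bar>\<xi> \<bullet> c\<bar>)" by (rule norm_le_l1)
    also have "\<dots> \<le> real DIM('a) * \<bar>\<xi> \<bullet> b\<bar>" by (rule sum_bounded_above) (rule b(2))
    finally have "norm \<xi> ^ k \<le> (real DIM('a) * \<bar>\<xi> \<bullet> b\<bar>) ^ k" by (intro power_mono) auto
    then have "norm \<xi> ^ k * cmod (fourier_int \<phi> \<xi>)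
        \<le> real DIM('a) ^ k * (\<bar>\<xi> \<bullet> b\<bar> ^ k * cmod (fourier_int \<phi> \<xi>))"
      by (metis mult.assoc mult_right_mono norm_ge_zero power_mult_distrib)
    also have "\<dots> \<le> real DIM('a) ^ k * B b" by (intro mult_left_mono B b) simp
    also have "\<dots> \<le> real DIM('a) ^ k * (\<Sum>b\<in>Basis. B b)"
      using b(1) B0 by (intro mult_left_mono member_le_sum) auto
    finally show ?thesis by simp
  qed
  then show "bounded (range (\<lambda>\<xi>. norm \<xi> ^ k *\<^sub>R fourier_int \<phi> \<xi>))"
    unfolding bounded_iff by blast
qed

lemma fourier_int_integrable: "schwartz \<phi> \<Longrightarrow> integrable lborel (fourier_int \<phi>)"
  by (intro rapid_integrable fourier_int_rapid fourier_int_measurable schwartz_measurable)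

section \<open>The Gaussian and the inversion formula\<close>

definition gauss :: "'a::euclidean_space \<Rightarrow> complex" where
  "gauss x = of_real (exp (- (norm x)\<^sup>2 / 2))"

lemma gauss_measurable[measurable]: "gauss \<in> borel_measurable borel"
  unfolding gauss_def by measurable

text \<open>This is the characteristic function of the standard normal distribution, cleared of the
  factor 1 / sqrt (2 pi) in its density. Variance 1 makes the Gaussian its own transform up to that
  constant.\<close>

lemma gauss_real_integral:
  shows "integrable lborel (\<lambda>s::real. cis (s * u) * gauss s)"
    and "(LINT s|lborel. cis (s * u) * gauss (s::real)) = of_real (sqrt (2 * pi)) * gauss u"
proof -
  have d: "std_normal_density s = exp (- s\<^sup>2 / 2) / sqrt (2 * pi)" for s
    by (simp add: std_normal_density_def)
  have "integrable lborel std_normal_density" by (rule integrable_normal_density) simp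
  then have "integrable lborel (\<lambda>s. complex_of_real (sqrt (2 * pi) * std_normal_density s))"
    by (intro integrable_of_real integrable_mult_right)
  then have "integrable lborel (\<lambda>s::real. gauss s)" by (simp add: gauss_def d)
  then show "integrable lborel (\<lambda>s::real. cis (s * u) * gauss s)" by (rule cis_integrable) simp
  have "complex_of_real (exp (- u\<^sup>2 / 2)) = char std_normal_distribution u"
    by (simp add: char_std_normal_distribution)
  also have "\<dots> = (LINT s|lborel. std_normal_density s *\<^sub>R iexp (u * s))"
    unfolding char_def by (subst integral_density) (auto simp: normal_density_nonneg)
  also have "\<dots> = (LINT s|lborel. (cis (s * u) * gauss s) / of_real (sqrt (2 * pi)))"
    by (intro Bochner_Integration.integral_cong)
       (auto simp: d gauss_def scaleR_conv_of_real cis_conv_exp mult_ac)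
  finally show "(LINT s|lborel. cis (s * u) * gauss (s::real)) = of_real (sqrt (2 * pi)) * gauss u"
    by (simp add: gauss_def field_simps del: real_sqrt_mult)
qed

lemma gauss_prod: "(\<Prod>b\<in>Basis. gauss (x \<bullet> b :: real)) = gauss x"
proof -
  have "(norm x)\<^sup>2 = (\<Sum>b\<in>Basis. (x \<bullet> b)\<^sup>2)"
    by (subst power2_norm_eq_inner, subst euclidean_inner) (simp add: power2_eq_square)
  then show ?thesis
    by (simp add: gauss_def of_real_prod[symmetric] exp_sum[symmetric] sum_negf sum_divide_distrib)
qed

lemma gauss_integral:
  fixes u :: "'a::euclidean_space"
  shows "integrable lborel (\<lambda>x::'a. cis (x \<bullet> u) * gauss x)"
    and "(LINT x|lborel. cis (x \<bullet> u) * gauss x) = of_real (sqrt (2 * pi) ^ DIM('a)) * gauss u"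
proof -
  have "(\<Prod>b\<in>(Basis::'a set). cis (f b)) = cis (\<Sum>b\<in>Basis. f b)" for f
    by (simp add: cis_conv_exp exp_sum sum_distrib_left)
  then have eq: "(\<Prod>b\<in>Basis. cis ((x \<bullet> b) * (u \<bullet> b)) * gauss (x \<bullet> b :: real)) = cis (x \<bullet> u) * gauss x" for x
    by (simp add: prod.distrib gauss_prod euclidean_inner[of x u])
  show "integrable lborel (\<lambda>x::'a. cis (x \<bullet> u) * gauss x)"
    using lborel_integrable_prod_Basis[of "\<lambda>b s. cis (s * (u \<bullet> b)) * gauss s"]
    by (simp add: gauss_real_integral eq)
  show "(LINT x|lborel. cis (x \<bullet> u) * gauss x) = of_real (sqrt (2 * pi) ^ DIM('a)) * gauss u"
    using lborel_integral_prod_Basis[of "\<lambda>b s. cis (s * (u \<bullet> b)) * gauss s", OF gauss_real_integral(1)]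
    unfolding eq gauss_real_integral(2) by (simp add: prod.distrib gauss_prod)
qed

lemma gauss_integrable: "integrable lborel gauss"
  using gauss_integral(1)[of 0] by simp

lemma gauss_scaled:
  fixes u :: "'a::euclidean_space"
  assumes "e > 0"
  shows "integrable lborel (\<lambda>x::'a. gauss (e *\<^sub>R x))"
    and "(LINT x|lborel. cis (x \<bullet> u) * gauss (e *\<^sub>R x))
      = of_real (sqrt (2 * pi) ^ DIM('a) / e ^ DIM('a)) * gauss (u /\<^sub>R e)"
proof -
  show "integrable lborel (\<lambda>x::'a. gauss (e *\<^sub>R x))"
    using lborel_integral_affine(2)[of e gauss 0] gauss_integrable assms by simp
  have "(LINT x|lborel. cis (x \<bullet> u) * gauss (e *\<^sub>R x))
      = inverse e ^ DIM('a) *\<^sub>R (LINT x|lborel. cis (x \<bullet> (u /\<^sub>R e)) * gauss x)"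
    using assms by (subst lborel_integral_affine(1)[where t=0 and c="inverse e"]) auto
  then show "(LINT x|lborel. cis (x \<bullet> u) * gauss (e *\<^sub>R x))
      = of_real (sqrt (2 * pi) ^ DIM('a) / e ^ DIM('a)) * gauss (u /\<^sub>R e)"
    by (simp only: gauss_integral) (simp add: scaleR_conv_of_real power_inverse divide_inverse)
qed

text \<open>Inserting the integral for \<open>fourier_int\<close> directly leaves a double integral
  that does not converge absolutely. The regulariser \<open>gauss (e *\<^sub>R x)\<close> repairs
  this; exchanging the order then produces averages of \<open>\<phi>\<close> against Gaussians of
  width e around y, and e tends to 0 on both sides.\<close>

theorem fourier_inversion:
  fixes \<phi> :: "'a::euclidean_space \<Rightarrow> complex"
  assumes \<phi>: "schwartz \<phi>"
  shows "(LINT x|lborel. cis (x \<bullet> y) * fourier_int \<phi> x) = of_real ((2 * pi) ^ DIM('a)) * \<phi> y"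
proof -
  define c where "c = complex_of_real (sqrt (2 * pi) ^ DIM('a))"
  define e where "e k = 1 / real (Suc k)" for k
  have e: "e k > 0" for k by (simp add: e_def)
  have e0: "e \<longlonglongrightarrow> 0"
    using LIMSEQ_inverse_real_of_nat by (simp add: e_def[abs_def] inverse_eq_divide)
  have [measurable]: "\<phi> \<in> borel_measurable borel" using \<phi> by (rule schwartz_measurable)
  have gb: "cmod (gauss (x::'a)) \<le> 1" for x by (simp add: gauss_def)
  have gc: "isCont gauss (x::'a)" for x unfolding gauss_def by (intro continuous_intros) auto
  have lim1: "(\<lambda>k. LINT x|lborel. gauss (e k *\<^sub>R x) * (cis (x \<bullet> y) * fourier_int \<phi> x))
      \<longlonglongrightarrow> (LINT x|lborel. gauss (0::'a) * (cis (x \<bullet> y) * fourier_int \<phi> x))"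
  proof (rule integral_dominated_convergence)
    show "integrable lborel (\<lambda>x. cmod (fourier_int \<phi> x))"
      using fourier_int_integrable[OF \<phi>] by (rule integrable_norm)
    show "AE x in lborel. (\<lambda>k. gauss (e k *\<^sub>R x) * (cis (x \<bullet> y) * fourier_int \<phi> x))
        \<longlonglongrightarrow> gauss (0::'a) * (cis (x \<bullet> y) * fourier_int \<phi> x)"
    proof (intro AE_I2 tendsto_mult tendsto_const)
      fix x :: 'a
      have "(\<lambda>k. e k *\<^sub>R x) \<longlonglongrightarrow> 0 *\<^sub>R x" by (intro tendsto_scaleR e0 tendsto_const)
      then show "(\<lambda>k. gauss (e k *\<^sub>R x)) \<longlonglongrightarrow> gauss (0::'a)"
        using isCont_tendsto_compose[OF gc[of 0]] by simp
    qed
    show "AE x in lborel. cmod (gauss (e k *\<^sub>R x) * (cis (x \<bullet> y) * fourier_int \<phi> x)) \<le> cmod (fourier_int \<phi> x)" for k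
      using gb by (intro AE_I2) (simp add: norm_mult mult_left_le_one_le)
  qed measurable
  have lim2: "(\<lambda>k. LINT v|lborel. gauss v * \<phi> (y + e k *\<^sub>R v)) \<longlonglongrightarrow> (LINT v|lborel. gauss (v::'a) * \<phi> y)"
  proof -
    obtain C where C: "C > 0" "\<And>x. cmod (\<phi> x) \<le> C / (1 + norm x) ^ 0"
      using rapid_bound[OF schwartz_rapid[OF \<phi>], of 0] by blast
    show ?thesis
    proof (rule integral_dominated_convergence)
      show "integrable lborel (\<lambda>x::'a. cmod (gauss x) * C)"
        by (intro integrable_mult_left integrable_norm gauss_integrable)
      show "AE v in lborel. (\<lambda>k. gauss v * \<phi> (y + e k *\<^sub>R v)) \<longlonglongrightarrow> gauss (v::'a) * \<phi> y"
      proof (intro AE_I2 tendsto_mult tendsto_const)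
        fix v :: 'a
        have "(\<lambda>k. y + e k *\<^sub>R v) \<longlonglongrightarrow> y + 0 *\<^sub>R v" by (intro tendsto_add tendsto_scaleR e0 tendsto_const)
        moreover have "isCont \<phi> y"
          using schwartz_continuous[OF \<phi>] by (simp add: continuous_on_eq_continuous_at)
        ultimately show "(\<lambda>k. \<phi> (y + e k *\<^sub>R v)) \<longlonglongrightarrow> \<phi> y"
          using isCont_tendsto_compose[of y \<phi>] by simp
      qed
      show "AE v in lborel. cmod (gauss v * \<phi> (y + e k *\<^sub>R v)) \<le> cmod (gauss v) * C" for k
        using C(2) by (intro AE_I2) (simp add: norm_mult mult_left_mono)
    qed measurable
  qed
  have eq: "(LINT x|lborel. gauss (e k *\<^sub>R x) * (cis (x \<bullet> y) * fourier_int \<phi> x))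
      = c * (LINT v|lborel. gauss v * \<phi> (y + e k *\<^sub>R v))" for k
  proof -
    have int: "integrable (lborel \<Otimes>\<^sub>M lborel)
        (\<lambda>(x, z). gauss (e k *\<^sub>R x) * (cis (x \<bullet> (y - z)) * \<phi> z))"
      by (rule integrable_unimodular[OF integrable_pair_mult[OF _ _
            gauss_scaled(1)[OF e[of k]] schwartz_integrable[OF \<phi>]]])
         (auto simp: norm_mult lborel.sigma_finite_measure_axioms)
    have "cis (x \<bullet> y) * cis (- (z \<bullet> x)) = cis (x \<bullet> (y - z))" for x z
      by (simp add: cis_mult inner_diff_right inner_commute[of z x])
    then have cc: "cis (x \<bullet> y) * (cis (- (z \<bullet> x)) * \<phi> z) = cis (x \<bullet> (y - z)) * \<phi> z" for x z
      by (metis mult.assoc)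
    have "(LINT x|lborel. gauss (e k *\<^sub>R x) * (cis (x \<bullet> y) * fourier_int \<phi> x))
        = (LINT x|lborel. (LINT z|lborel. gauss (e k *\<^sub>R x) * (cis (x \<bullet> (y - z)) * \<phi> z)))"
      unfolding fourier_int_def integral_mult_right_zero[symmetric] cc ..
    also have "\<dots> = (LINT z|lborel. (LINT x|lborel. gauss (e k *\<^sub>R x) * (cis (x \<bullet> (y - z)) * \<phi> z)))"
      by (rule lborel_pair.Fubini_integral[OF int, symmetric])
    also have "\<dots> = (LINT z|lborel. (LINT x|lborel. cis (x \<bullet> (y - z)) * gauss (e k *\<^sub>R x)) * \<phi> z)"
      unfolding integral_mult_left_zero[symmetric] by (simp only: mult_ac)
    also have "\<dots> = (LINT z|lborel. (c / of_real (e k ^ DIM('a))) * (gauss ((y - z) /\<^sub>R e k) * \<phi> z))"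
      by (simp add: gauss_scaled[OF e] c_def mult.assoc)
    also have "\<dots> = (c / of_real (e k ^ DIM('a))) * (LINT z|lborel. gauss ((y - z) /\<^sub>R e k) * \<phi> z)"
      by (rule integral_mult_right_zero)
    \<comment> \<open>Substituting z = y + e v cancels the factor e^(-d) of the scaled transform;
      the Gaussian is even, which removes the sign of v.\<close>
    also have "(LINT z|lborel. gauss ((y - z) /\<^sub>R e k) * \<phi> z)
        = e k ^ DIM('a) *\<^sub>R (LINT v|lborel. gauss v * \<phi> (y + e k *\<^sub>R v))"
      using e[of k]
      by (subst lborel_integral_affine(1)[where t=y and c="e k"]) (auto simp: gauss_def)
    finally show ?thesis using e[of k] by (simp add: scaleR_conv_of_real)
  qed
  \<comment> \<open>One factor c comes from the transform of the regulariser, the other from the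
    total mass of the Gaussian; together they make (2 pi)^d.\<close>
  have "(LINT v|lborel. gauss (v::'a) * \<phi> y) = c * \<phi> y"
    using gauss_integral(2)[of "0::'a"] by (simp add: c_def gauss_def)
  then have "(LINT x|lborel. cis (x \<bullet> y) * fourier_int \<phi> x) = c * (c * \<phi> y)"
    using LIMSEQ_unique[OF lim1[unfolded eq] tendsto_mult[OF tendsto_const[of c] lim2]]
    by (simp add: gauss_def)
  moreover have "sqrt (2 * pi) ^ DIM('a) * sqrt (2 * pi) ^ DIM('a) = (2 * pi) ^ DIM('a)"
    unfolding power_mult_distrib[symmetric] by (simp only: real_sqrt_mult_self) simp
  then have "c * c = of_real ((2 * pi) ^ DIM('a))"
    unfolding c_def of_real_mult[symmetric] by (rule arg_cong)
  ultimately show ?thesis by (metis mult.assoc)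
qed

text \<open>Fubini, then inversion at each \<open>T m\<close>: a superposition of plane waves with
  frequencies \<open>T m\<close> has as its transform (2 pi)^d times the image under T of the
  weighted measure. With T the identity this gives the transform of a wave packet, with T =
  \<open>wave_pair\<close> that of its squared half-wave.\<close>

theorem fourier_inversion_superposition:
  fixes \<phi> :: "'a::euclidean_space \<Rightarrow> complex"
  assumes M: "sigma_finite_measure M" and \<phi>: "schwartz \<phi>"
    and g: "integrable M g" and [measurable]: "T \<in> M \<rightarrow>\<^sub>M borel"
  shows "(LINT x|lborel. (LINT m|M. cis (x \<bullet> T m) * g m) * fourier_int \<phi> x)
      = of_real ((2 * pi) ^ DIM('a)) * (LINT m|M. g m * \<phi> (T m))"
proof -
  interpret sigma_finite_measure M by fact
  interpret pair_sigma_finite lborel M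
    by (simp add: pair_sigma_finite_def M lborel.sigma_finite_measure_axioms)
  have [measurable]: "\<phi> \<in> borel_measurable borel" using \<phi> by (rule schwartz_measurable)
  have [measurable]: "g \<in> borel_measurable M" using g by simp
  have [measurable]: "fourier_int \<phi> \<in> borel_measurable borel" by measurable
  have int: "integrable (lborel \<Otimes>\<^sub>M M) (\<lambda>(x, m). cis (x \<bullet> T m) * g m * fourier_int \<phi> x)"
    by (rule integrable_unimodular[OF integrable_pair_mult[OF _ _ fourier_int_integrable[OF \<phi>] g]])
       (auto simp: norm_mult lborel.sigma_finite_measure_axioms M)
  have "(LINT x|lborel. (LINT m|M. cis (x \<bullet> T m) * g m) * fourier_int \<phi> x)
      = (LINT x|lborel. (LINT m|M. cis (x \<bullet> T m) * g m * fourier_int \<phi> x))"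
    by (simp only: integral_mult_left_zero)
  also have "\<dots> = (LINT m|M. (LINT x|lborel. cis (x \<bullet> T m) * g m * fourier_int \<phi> x))"
    by (rule Fubini_integral[OF int, symmetric])
  also have "\<dots> = (LINT m|M. g m * (LINT x|lborel. cis (x \<bullet> T m) * fourier_int \<phi> x))"
    unfolding integral_mult_right_zero[symmetric] by (simp add: mult_ac)
  also have "\<dots> = (LINT m|M. of_real ((2 * pi) ^ DIM('a)) * (g m * \<phi> (T m)))"
    unfolding fourier_inversion[OF \<phi>] by (simp only: mult_ac)
  finally show ?thesis by (simp only: integral_mult_right_zero)
qed

section \<open>Uniqueness of the Fourier transform\<close>

text \<open>Products of \<open>exp (- ((s - c) / r) ^ (2m))\<close> over the coordinates are Schwartz functions, and as
  \<open>m\<close> grows they converge to the indicator of a box; no smooth bump function is needed.\<close>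

definition poly_exp :: "real poly \<Rightarrow> real poly \<Rightarrow> real \<Rightarrow> complex" where
  "poly_exp q p s = of_real (poly p s * exp (- poly q s))"

definition test_prod :: "('a::euclidean_space \<Rightarrow> real poly) \<Rightarrow> ('a \<Rightarrow> real poly) \<Rightarrow> 'a \<Rightarrow> complex" where
  "test_prod q p x = (\<Prod>b\<in>Basis. poly_exp (q b) (p b) (x \<bullet> b))"

lemma poly_exp_derivative:
  "(poly_exp q p has_vector_derivative poly_exp q (pderiv p - p * pderiv q) s) (at s)"
proof -
  have "((\<lambda>s. poly p s * exp (- poly q s)) has_real_derivative
      poly (pderiv p - p * pderiv q) s * exp (- poly q s)) (at s)"
    by (auto intro!: derivative_eq_intros simp: algebra_simps)
  from has_vector_derivative_of_real[OF this] show ?thesis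
    by (simp add: poly_exp_def[abs_def])
qed

text \<open>A coordinate derivative changes only the prefactor in that coordinate and keeps
  \<open>q\<close>. All iterated derivatives thus stay in the family, and decay has to be proved
  only once, for arbitrary \<open>p\<close>.\<close>

lemma test_prod_derivative:
  fixes q p :: "'a::euclidean_space \<Rightarrow> real poly"
  shows test_prod_differentiable: "test_prod q p differentiable at x"
    and test_prod_frechet: "v \<in> Basis \<Longrightarrow>
      frechet_derivative (test_prod q p) (at x) v
        = test_prod q (p(v := pderiv (p v) - p v * pderiv (q v))) x"
proof -
  define p' where "p' b = pderiv (p b) - p b * pderiv (q b)" for b
  have d: "((\<lambda>x. poly_exp (q b) (p b) (x \<bullet> b)) has_derivative
      (\<lambda>y. (y \<bullet> b) *\<^sub>R poly_exp (q b) (p' b) (x \<bullet> b))) (at x)" for b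
  proof -
    have "((\<lambda>x. x \<bullet> b) has_derivative (\<lambda>y. y \<bullet> b)) (at x)"
      by (auto intro!: derivative_eq_intros)
    then show ?thesis
      using poly_exp_derivative[of "q b" "p b" "x \<bullet> b"] unfolding has_vector_derivative_def p'_def
      by (rule has_derivative_compose)
  qed
  have D: "(test_prod q p has_derivative (\<lambda>y. \<Sum>b\<in>Basis. (y \<bullet> b) *\<^sub>R poly_exp (q b) (p' b) (x \<bullet> b) *
      (\<Prod>c\<in>Basis - {b}. poly_exp (q c) (p c) (x \<bullet> c)))) (at x)" 
    unfolding test_prod_def[abs_def] by (rule has_derivative_prod) (rule d)
  show "test_prod q p differentiable at x" using D by (rule differentiableI)
  assume v: "v \<in> Basis"
  have "frechet_derivative (test_prod q p) (at x) v = (\<Sum>b\<in>Basis. (v \<bullet> b) *\<^sub>R poly_exp (q b) (p' b) (x \<bullet> b) *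
      (\<Prod>c\<in>Basis - {b}. poly_exp (q c) (p c) (x \<bullet> c)))"
    unfolding frechet_derivative_at[OF D, symmetric] ..
  also have "\<dots> = (\<Sum>b\<in>Basis. if b = v then poly_exp (q v) (p' v) (x \<bullet> v) *
      (\<Prod>c\<in>Basis - {v}. poly_exp (q c) (p c) (x \<bullet> c)) else 0)"
    using v by (intro sum.cong refl) (auto simp: inner_Basis)
  also have "\<dots> = poly_exp (q v) (p' v) (x \<bullet> v) * (\<Prod>c\<in>Basis - {v}. poly_exp (q c) (p c) (x \<bullet> c))"
    using v by simp
  also have "(\<Prod>c\<in>Basis - {v}. poly_exp (q c) (p c) (x \<bullet> c))
      = (\<Prod>c\<in>Basis - {v}. poly_exp (q c) ((p(v := p' v)) c) (x \<bullet> c))"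
    by (intro prod.cong) auto
  also have "poly_exp (q v) (p' v) (x \<bullet> v) * \<dots> = test_prod q (p(v := p' v)) x"
    unfolding test_prod_def by (subst prod.remove[OF finite_Basis v]) simp
  finally show "frechet_derivative (test_prod q p) (at x) v
      = test_prod q (p(v := pderiv (p v) - p v * pderiv (q v))) x"
    by (simp add: p'_def)
qed

lemma poly_growth: "\<exists>C n. \<forall>s::real. \<bar>poly p s\<bar> \<le> C * (1 + \<bar>s\<bar>) ^ n"
proof (induction p)
  case 0
  have "\<forall>s::real. \<bar>poly 0 s\<bar> \<le> 0 * (1 + \<bar>s\<bar>) ^ 0" by simp
  then show ?case by blast
next
  case (pCons a p)
  then obtain C n where C: "\<And>s. \<bar>poly p s\<bar> \<le> C * (1 + \<bar>s\<bar>) ^ n" by blast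
  have "\<bar>poly (pCons a p) s\<bar> \<le> (\<bar>a\<bar> + C) * (1 + \<bar>s\<bar>) ^ Suc n" for s
  proof -
    have "\<bar>poly p 0\<bar> \<le> C" using C[of 0] by simp
    then have C0: "0 \<le> C" by linarith
    have "\<bar>poly (pCons a p) s\<bar> \<le> \<bar>a\<bar> + \<bar>s\<bar> * \<bar>poly p s\<bar>"
      using abs_triangle_ineq[of a "s * poly p s"] by (simp add: abs_mult)
    also have "\<dots> \<le> \<bar>a\<bar> * 1 + (1 + \<bar>s\<bar>) * (C * (1 + \<bar>s\<bar>) ^ n)"
      using C[of s] C0 by (intro add_mono mult_mono) auto
    also have "\<dots> \<le> \<bar>a\<bar> * (1 + \<bar>s\<bar>) ^ Suc n + (1 + \<bar>s\<bar>) * (C * (1 + \<bar>s\<bar>) ^ n)"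
      using one_le_power[of "1 + \<bar>s\<bar>" "Suc n"] by (intro add_right_mono mult_left_mono) auto
    finally show ?thesis by (simp add: algebra_simps)
  qed
  then show ?case by blast
qed

lemma power_le_fact_exp: "t ^ k \<le> fact k * exp t" if "t \<ge> 0" for t :: real
proof -
  have "(\<Sum>n\<in>{k}. t ^ n /\<^sub>R fact n) \<le> (\<Sum>n. t ^ n /\<^sub>R fact n)"
    using that summable_exp_generic[of t] by (intro sum_le_suminf) auto
  then show ?thesis by (simp add: exp_def field_simps)
qed

text \<open>Any power of 1 + |s| is at most a constant times exp (1 + a s^2), while the lower bound
  on \<open>q\<close> makes exp (- q) at most exp (d - a s^2). The two exponentials cancel up to a
  constant.\<close>

lemma poly_exp_decay:
  assumes "a > 0" and q: "\<And>s. a * s\<^sup>2 - d \<le> poly q s"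
  shows "\<exists>B. \<forall>s. (1 + \<bar>s\<bar>) ^ k * cmod (poly_exp q p s) \<le> B"
proof -
  obtain C n where C: "\<And>s. \<bar>poly p s\<bar> \<le> C * (1 + \<bar>s\<bar>) ^ n" using poly_growth by blast
  have C0: "0 \<le> C" using C[of 0] by simp
  define K where "K = k + n"
  \<comment> \<open>Large enough for both coefficients in 2 + 2 s^2 <= A (1 + a s^2).\<close>
  define A where "A = 2 + 2 / a"
  have A: "A > 0" using assms(1) by (simp add: A_def add_pos_pos)
  have "(1 + \<bar>s\<bar>) ^ k * cmod (poly_exp q p s) \<le> C * (A ^ K * fact K * exp (1 + d))" for s
  proof -
    have "(1 + \<bar>s\<bar>) ^ K \<le> ((1 + \<bar>s\<bar>)\<^sup>2) ^ K"
      by (intro power_mono) (auto simp: power2_eq_square algebra_simps)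
    also have "\<dots> \<le> (A * (1 + a * s\<^sup>2)) ^ K"
    proof (intro power_mono)
      have "(1 + \<bar>s\<bar>)\<^sup>2 \<le> 2 + 2 * s\<^sup>2"
        using sum_squares_ge_zero[of "1 - \<bar>s\<bar>" 0] by (simp add: power2_eq_square algebra_simps)
      also have "\<dots> \<le> A * (1 + a * s\<^sup>2)"
        using assms(1) by (simp add: A_def distrib_left distrib_right)
      finally show "(1 + \<bar>s\<bar>)\<^sup>2 \<le> A * (1 + a * s\<^sup>2)" .
    qed simp
    also have "\<dots> = A ^ K * (1 + a * s\<^sup>2) ^ K" by (rule power_mult_distrib)
    also have "\<dots> \<le> A ^ K * (fact K * exp (1 + a * s\<^sup>2))"
      using A assms(1) by (intro mult_left_mono power_le_fact_exp) auto
    finally have 1: "(1 + \<bar>s\<bar>) ^ K \<le> A ^ K * (fact K * exp (1 + a * s\<^sup>2))" .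
    have "(1 + \<bar>s\<bar>) ^ k * cmod (poly_exp q p s) = (1 + \<bar>s\<bar>) ^ k * \<bar>poly p s\<bar> * exp (- poly q s)"
      by (simp add: poly_exp_def norm_mult)
    also have "\<dots> \<le> (1 + \<bar>s\<bar>) ^ k * (C * (1 + \<bar>s\<bar>) ^ n) * exp (- (a * s\<^sup>2 - d))"
      using q[of s] C[of s] C0 by (intro mult_mono) auto
    also have "\<dots> = C * ((1 + \<bar>s\<bar>) ^ K * exp (d - a * s\<^sup>2))"
      by (simp add: K_def power_add)
    also have "\<dots> \<le> C * (A ^ K * (fact K * exp (1 + a * s\<^sup>2)) * exp (d - a * s\<^sup>2))"
      using C0 1 by (intro mult_left_mono mult_right_mono) auto
    also have "\<dots> = C * (A ^ K * fact K * (exp (1 + a * s\<^sup>2) * exp (d - a * s\<^sup>2)))"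
      by (simp only: mult_ac)
    also have "exp (1 + a * s\<^sup>2) * exp (d - a * s\<^sup>2) = exp (1 + d)"
      by (simp add: exp_add[symmetric])
    finally show ?thesis .
  qed
  then show ?thesis by blast
qed

lemma test_prod_rapid:
  fixes q p :: "'a::euclidean_space \<Rightarrow> real poly"
  assumes "\<And>b. b \<in> Basis \<Longrightarrow> a b > 0" and q: "\<And>b s. b \<in> Basis \<Longrightarrow> a b * s\<^sup>2 - d b \<le> poly (q b) s"
  shows "rapid (test_prod q p)"
  unfolding rapid_def
proof
  fix k
  have "\<forall>b\<in>Basis. \<exists>B. \<forall>s. (1 + \<bar>s\<bar>) ^ k * cmod (poly_exp (q b) (p b) s) \<le> B"
    using poly_exp_decay[OF assms(1) q] by blast
  then obtain B where B: "\<And>b s. b \<in> Basis \<Longrightarrow> (1 + \<bar>s\<bar>) ^ k * cmod (poly_exp (q b) (p b) s) \<le> B b"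
    by metis
  have "cmod (norm x ^ k *\<^sub>R test_prod q p x) \<le> (\<Prod>b\<in>Basis. B b)" for x :: 'a
  proof -
    \<comment> \<open>Expanding the product of the 1 + |x_b| yields each |x_b| as a term. A power of
      |x| is thereby distributed over the factors, one coordinate each.\<close>
    have sum_le: "(\<Sum>b\<in>I. \<bar>x \<bullet> b\<bar>) \<le> (\<Prod>b\<in>I. 1 + \<bar>x \<bullet> b\<bar>)" if "finite I" for I
      using that
    proof induction
      case (insert i I)
      have "1 \<le> (\<Prod>b\<in>I. 1 + \<bar>x \<bullet> b\<bar>)" by (rule prod_ge_1) simp
      then have "\<bar>x \<bullet> i\<bar> * 1 \<le> \<bar>x \<bullet> i\<bar> * (\<Prod>b\<in>I. 1 + \<bar>x \<bullet> b\<bar>)" by (rule mult_left_mono) simp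
      then show ?case using insert by (simp add: distrib_right)
    qed simp
    have "norm x ^ k \<le> (\<Prod>b\<in>Basis. 1 + \<bar>x \<bullet> b\<bar>) ^ k"
      by (intro power_mono order_trans[OF norm_le_l1] sum_le) auto
    then have "norm x ^ k * cmod (test_prod q p x)
        \<le> (\<Prod>b\<in>Basis. 1 + \<bar>x \<bullet> b\<bar>) ^ k * cmod (test_prod q p x)"
      by (rule mult_right_mono) simp
    also have "\<dots> = (\<Prod>b\<in>Basis. (1 + \<bar>x \<bullet> b\<bar>) ^ k * cmod (poly_exp (q b) (p b) (x \<bullet> b)))"
      by (simp add: test_prod_def prod.distrib prod_norm prod_power_distrib)
    also have "\<dots> \<le> (\<Prod>b\<in>Basis. B b)" using B by (intro prod_mono) auto
    finally show ?thesis by simp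
  qed
  then show "bounded (range (\<lambda>x. norm x ^ k *\<^sub>R test_prod q p x))"
    unfolding bounded_iff by blast
qed

lemma test_prod_schwartz:
  fixes q p :: "'a::euclidean_space \<Rightarrow> real poly"
  assumes a: "\<And>b. b \<in> Basis \<Longrightarrow> a b > 0" and q: "\<And>b s. b \<in> Basis \<Longrightarrow> a b * s\<^sup>2 - d b \<le> poly (q b) s"
  shows "schwartz (test_prod q p)"
proof -
  have "\<exists>p'. iter_dderiv vs (test_prod q p) = test_prod q p'" if "set vs \<subseteq> Basis" for vs
    using that
  proof (induction vs)
    case Nil
    then show ?case by auto
  next
    case (Cons v vs)
    then obtain p' where p': "iter_dderiv vs (test_prod q p) = test_prod q p'" by auto
    have "iter_dderiv (v # vs) (test_prod q p) = test_prod q (p'(v := pderiv (p' v) - p' v * pderiv (q v)))"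
      using Cons.prems by (simp add: p' test_prod_frechet fun_eq_iff)
    then show ?case by blast
  qed
  moreover have "rapid (test_prod q p')" for p' using test_prod_rapid[OF a q] .
  ultimately show ?thesis
    unfolding schwartz_def using test_prod_differentiable rapid_def by metis
qed

section \<open>Tempered functions tested against Schwartz functions\<close>

lemma tempered_mult_rapid_integrable:
  assumes G: "tempered G" and \<phi>: "rapid \<phi>" and [measurable]: "\<phi> \<in> borel_measurable borel"
  shows "integrable lborel (\<lambda>x. G x * \<phi> x)"
proof -
  obtain N where N: "integrable lborel (\<lambda>x. G x / of_real ((1 + norm x) ^ N))"
    and [measurable]: "G \<in> borel_measurable borel"
    using G unfolding tempered_def by blast
  obtain C where C: "C > 0" "\<And>x. cmod (\<phi> x) \<le> C / (1 + norm x) ^ N"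
    using rapid_bound[OF \<phi>, of N] by blast
  have "integrable lborel (\<lambda>x. of_real C * (G x / of_real ((1 + norm x) ^ N)))"
    using N by (rule integrable_mult_right)
  then show ?thesis
  proof (rule Bochner_Integration.integrable_bound)
    show "AE x in lborel. cmod (G x * \<phi> x) \<le> cmod (of_real C * (G x / of_real ((1 + norm x) ^ N)))"
    proof (intro AE_I2)
      fix x
      have "cmod (G x * \<phi> x) \<le> cmod (G x) * (C / (1 + norm x) ^ N)"
        using C(2)[of x] by (simp add: norm_mult mult_left_mono del: times_divide_eq_right)
      also have "\<dots> = cmod (of_real C * (G x / of_real ((1 + norm x) ^ N)))"
        using C(1) by (simp add: norm_mult norm_divide norm_power abs_of_nonneg add_nonneg_nonneg
            del: of_real_add of_real_power)
      finally show "cmod (G x * \<phi> x) \<le> cmod (of_real C * (G x / of_real ((1 + norm x) ^ N)))" .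
    qed
  qed measurable
qed

lemma tempered_mult_schwartz_integrable:
  "tempered G \<Longrightarrow> schwartz \<phi> \<Longrightarrow> integrable lborel (\<lambda>x. G x * \<phi> x)"
  by (intro tempered_mult_rapid_integrable schwartz_rapid schwartz_measurable)

lemma tempered_indicator_integrable:
  assumes "tempered G" "bounded S" and [measurable]: "S \<in> sets borel"
  shows "integrable lborel (\<lambda>x. indicat_real S x *\<^sub>R G x)"
proof -
  obtain B where B: "\<And>x. x \<in> S \<Longrightarrow> norm x \<le> B" using assms(2) by (auto simp: bounded_iff)
  have "rapid (\<lambda>x. of_real (indicat_real S x))"
    unfolding rapid_def
  proof
    fix k
    have "norm (norm x ^ k *\<^sub>R complex_of_real (indicat_real S x)) \<le> \<bar>B\<bar> ^ k" for x
    proof (cases "x \<in> S")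
      case True
      then show ?thesis using B[of x] by (auto intro!: power_mono)
    qed simp
    then show "bounded (range (\<lambda>x. norm x ^ k *\<^sub>R complex_of_real (indicat_real S x)))"
      unfolding bounded_iff by blast
  qed
  from tempered_mult_rapid_integrable[OF assms(1) this] show ?thesis
    by (simp add: scaleR_conv_of_real mult.commute)
qed

text \<open>At |y| = 1 the sequence is constantly exp (-1). In the application these points are the
  faces of a box.\<close>

lemma exp_neg_even_power_LIMSEQ:
  fixes y :: real
  assumes "\<bar>y\<bar> \<noteq> 1"
  shows "(\<lambda>k. exp (- (y ^ (2 * Suc k)))) \<longlonglongrightarrow> (if \<bar>y\<bar> < 1 then 1 else 0)"
proof (cases "\<bar>y\<bar> < 1")
  case True
  have "(\<lambda>k. (y\<^sup>2) ^ Suc k) \<longlonglongrightarrow> 0"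
    using True by (intro LIMSEQ_Suc LIMSEQ_power_zero) (simp add: power2_eq_square abs_square_less_1 flip: power2_eq_square)
  then have "(\<lambda>k. exp (- ((y\<^sup>2) ^ Suc k))) \<longlonglongrightarrow> exp (- 0)" by (intro tendsto_intros)
  then show ?thesis using True by (simp only: power_mult) simp
next
  case False
  then have "y\<^sup>2 > 1" using assms by (meson abs_square_le_1 not_le less_le)
  then have "filterlim (\<lambda>k. (y\<^sup>2) ^ Suc k) at_top sequentially"
    using filterlim_compose[OF filterlim_at_infinity_imp_norm_at_top[OF
        filterlim_realpow_sequentially_gt1[of "y\<^sup>2"]] filterlim_Suc]
    by (simp add: norm_power)
  then have "filterlim (\<lambda>k. - ((y\<^sup>2) ^ Suc k)) at_bot sequentially"
    by (simp only: filterlim_uminus_at_top)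
  then have "(\<lambda>k. exp (- ((y\<^sup>2) ^ Suc k))) \<longlonglongrightarrow> 0"
    by (rule filterlim_compose[OF exp_at_bot])
  then show ?thesis using False by (simp only: power_mult) simp
qed

lemma tempered_box_integral_zero:
  fixes G :: "'a::euclidean_space \<Rightarrow> complex"
  assumes G: "tempered G" and zero: "\<And>\<phi>. schwartz \<phi> \<Longrightarrow> (LINT x|lborel. G x * \<phi> x) = 0"
  shows "(LINT x|lborel. indicat_real (box l u) x *\<^sub>R G x) = 0"
proof (cases "box l u = {}")
  case False
  then have lu: "l \<bullet> b < u \<bullet> b" if "b \<in> Basis" for b using that by (simp add: box_ne_empty)
  define c where "c b = (l \<bullet> b + u \<bullet> b) / 2" for b
  define r where "r b = (u \<bullet> b - l \<bullet> b) / 2" for b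
  have r: "r b > 0" if "b \<in> Basis" for b using lu[OF that] by (simp add: r_def)
  \<comment> \<open>With c the midpoint and r the half-length, |(s - c) / r| < 1 describes the open
    side of the box. The exponent starts at 2, so that k = 0 already gives a Gaussian.\<close>
  define q where "q k b = [: - c b / r b, 1 / r b :] ^ (2 * Suc k)" for k b
  define p where "p b = (1 :: real poly)" for b :: 'a
  define y where "y b x = (x \<bullet> b - c b) / r b" for b x :: 'a
  have q: "poly (q k b) s = ((s - c b) / r b) ^ (2 * Suc k)" if "b \<in> Basis" for k b s
    using r[OF that] by (simp add: q_def poly_power diff_divide_distrib del: power_Suc)
  \<comment> \<open>Serves twice: it provides the quadratic lower bound that makes every test
    function Schwartz, and after exponentiation exp (- t^(2k+2)) <= exp 1 * exp (- t^2), which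
    dominates the whole sequence by its first member.\<close>
  have ev: "t\<^sup>2 - 1 \<le> t ^ (2 * Suc k)" for t :: real and k
  proof (cases "t\<^sup>2 \<le> 1")
    case True
    have "0 \<le> t ^ (2 * Suc k)" by (rule zero_le_even_power) simp
    then show ?thesis using True by linarith
  next
    case False
    then have "(t\<^sup>2) ^ 1 \<le> (t\<^sup>2) ^ Suc k" by (intro power_increasing) auto
    then show ?thesis by (simp only: power_mult) simp
  qed
  have lower: "1 / (2 * (r b)\<^sup>2) * s\<^sup>2 - ((c b / r b)\<^sup>2 + 1) \<le> poly (q k b) s" if "b \<in> Basis" for k b s
  proof -
    have "x\<^sup>2 / 2 - z\<^sup>2 \<le> (x - z)\<^sup>2" for x z :: real
      using zero_le_power2[of "x - 2 * z"] by (simp add: power2_eq_square algebra_simps)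
    from this[of "s / r b" "c b / r b"]
    have "1 / (2 * (r b)\<^sup>2) * s\<^sup>2 - (c b / r b)\<^sup>2 \<le> ((s - c b) / r b)\<^sup>2"
      by (simp add: power_divide diff_divide_distrib mult.commute)
    also have "\<dots> \<le> ((s - c b) / r b) ^ (2 * Suc k) + 1" using ev[of "(s - c b) / r b" k] by linarith
    finally show ?thesis by (simp add: q[OF that])
  qed
  have S: "schwartz (test_prod (q k) p)" for k
    by (rule test_prod_schwartz[OF _ lower]) (use r in \<open>simp add: zero_less_power less_imp_neq[symmetric]\<close>)
  have eq: "test_prod (q k) p x = of_real (\<Prod>b\<in>Basis. exp (- (y b x ^ (2 * Suc k))))" for k x
    unfolding test_prod_def of_real_prod
    by (intro prod.cong) (simp_all add: poly_exp_def q p_def y_def del: power_Suc mult_Suc_right)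
  have "(\<lambda>k. LINT x|lborel. G x * test_prod (q k) p x) \<longlonglongrightarrow> (LINT x|lborel. indicat_real (box l u) x *\<^sub>R G x)"
  proof (rule integral_dominated_convergence)
    have [measurable]: "G \<in> borel_measurable borel" using G by (simp add: tempered_def)
    have [measurable]: "test_prod (q k) p \<in> borel_measurable borel" for k
      using S by (rule schwartz_measurable)
    show "(\<lambda>x. G x * test_prod (q k) p x) \<in> borel_measurable lborel" for k by measurable
    show "(\<lambda>x. indicat_real (box l u) x *\<^sub>R G x) \<in> borel_measurable lborel" by measurable
    show "integrable lborel (\<lambda>x. exp 1 ^ DIM('a) * cmod (G x * test_prod (q 0) p x))"
      by (intro integrable_mult_right integrable_norm tempered_mult_schwartz_integrable G S)
    show "AE x in lborel. cmod (G x * test_prod (q k) p x) \<le> exp 1 ^ DIM('a) * cmod (G x * test_prod (q 0) p x)" for k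
    proof (intro AE_I2)
      fix x
      have "(\<Prod>b\<in>Basis. exp (- (y b x ^ (2 * Suc k)))) \<le> (\<Prod>b\<in>(Basis::'a set). exp 1 * exp (- (y b x ^ (2 * Suc 0))))"
      proof (intro prod_mono conjI)
        fix b
        show "exp (- (y b x ^ (2 * Suc k))) \<le> exp 1 * exp (- (y b x ^ (2 * Suc 0)))"
          unfolding exp_add[symmetric] exp_le_cancel_iff using ev[of "y b x" k]
          by (simp del: power_Suc mult_Suc_right add: algebra_simps) (simp add: power2_eq_square)
      qed simp
      also have "\<dots> = exp 1 ^ DIM('a) * (\<Prod>b\<in>Basis. exp (- (y b x ^ (2 * Suc 0))))"
        by (simp add: prod.distrib)
      finally have "cmod (test_prod (q k) p x) \<le> exp 1 ^ DIM('a) * cmod (test_prod (q 0) p x)"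
        unfolding eq norm_of_real by (simp add: abs_of_nonneg prod_nonneg del: power_Suc mult_Suc_right)
      then have "cmod (G x) * cmod (test_prod (q k) p x) \<le> cmod (G x) * (exp 1 ^ DIM('a) * cmod (test_prod (q 0) p x))"
        by (rule mult_left_mono) simp
      then show "cmod (G x * test_prod (q k) p x) \<le> exp 1 ^ DIM('a) * cmod (G x * test_prod (q 0) p x)"
        by (simp add: norm_mult mult_ac)
    qed
    \<comment> \<open>Convergence to the indicator can fail only on the hyperplanes that carry the
      faces, and these are null.\<close>
    have "AE x in lborel. \<forall>b\<in>Basis. x \<bullet> b \<noteq> l \<bullet> b \<and> x \<bullet> b \<noteq> u \<bullet> b"
    proof (rule AE_finite_allI[OF finite_Basis])
      fix b :: 'a assume b: "b \<in> Basis"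
      have "AE x in lborel. x \<bullet> b \<noteq> t" for t
      proof -
        have "{x. x \<bullet> b = t} \<in> null_sets lborel"
          using negligible_standard_hyperplane[OF b, of t]
          by (simp add: negligible_iff_null_sets null_sets_completion_iff)
        from AE_not_in[OF this] show ?thesis by simp
      qed
      from this[of "l \<bullet> b"] this[of "u \<bullet> b"] show "AE x in lborel. x \<bullet> b \<noteq> l \<bullet> b \<and> x \<bullet> b \<noteq> u \<bullet> b"
        by eventually_elim simp
    qed
    then show "AE x in lborel. (\<lambda>k. G x * test_prod (q k) p x) \<longlonglongrightarrow> indicat_real (box l u) x *\<^sub>R G x"
    proof eventually_elim
      case (elim x)
      have y1: "\<bar>y b x\<bar> < 1 \<longleftrightarrow> l \<bullet> b < x \<bullet> b \<and> x \<bullet> b < u \<bullet> b" "\<bar>y b x\<bar> \<noteq> 1" if b: "b \<in> Basis" for b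
      proof -
        have "\<bar>y b x\<bar> = \<bar>x \<bullet> b - c b\<bar> / r b" using r[OF b] by (simp add: y_def abs_divide)
        then have "\<bar>y b x\<bar> < 1 \<longleftrightarrow> \<bar>x \<bullet> b - c b\<bar> < r b" "\<bar>y b x\<bar> = 1 \<longleftrightarrow> \<bar>x \<bullet> b - c b\<bar> = r b"
          using r[OF b] by (simp_all add: divide_less_eq divide_eq_eq)
        moreover have "\<bar>x \<bullet> b - c b\<bar> < r b \<longleftrightarrow> l \<bullet> b < x \<bullet> b \<and> x \<bullet> b < u \<bullet> b"
          unfolding c_def r_def by (auto simp: abs_if field_simps)
        moreover have "\<bar>x \<bullet> b - c b\<bar> \<noteq> r b"
          using elim b unfolding c_def r_def by (auto simp: abs_if field_simps)
        ultimately show "\<bar>y b x\<bar> < 1 \<longleftrightarrow> l \<bullet> b < x \<bullet> b \<and> x \<bullet> b < u \<bullet> b" "\<bar>y b x\<bar> \<noteq> 1" by auto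
      qed
      have "(\<lambda>k. \<Prod>b\<in>Basis. exp (- (y b x ^ (2 * Suc k)))) \<longlonglongrightarrow> (\<Prod>b\<in>Basis. if \<bar>y b x\<bar> < 1 then 1 else 0)"
        by (intro tendsto_prod exp_neg_even_power_LIMSEQ y1)
      also have "(\<Prod>b\<in>Basis. if \<bar>y b x\<bar> < 1 then 1 else (0::real)) = indicat_real (box l u) x"
      proof (cases "x \<in> box l u")
        case True
        then show ?thesis by (intro trans[OF prod.neutral]) (auto simp: y1 mem_box)
      next
        case False
        then obtain b where "b \<in> Basis" "\<not> \<bar>y b x\<bar> < 1" using y1 by (auto simp: mem_box)
        then have "(\<Prod>b\<in>Basis. if \<bar>y b x\<bar> < 1 then 1 else (0::real)) = 0"
          by (intro prod_zero) auto
        then show ?thesis using False by simp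
      qed
      finally have "(\<lambda>k. G x * test_prod (q k) p x) \<longlonglongrightarrow> G x * of_real (indicat_real (box l u) x)"
        unfolding eq by (intro tendsto_mult tendsto_const tendsto_of_real)
      then show ?case by (simp add: scaleR_conv_of_real mult.commute)
    qed
  qed
  then show ?thesis using zero[OF S] by (simp add: LIMSEQ_const_iff)
qed simp

text \<open>Open boxes form an intersection-stable generator of the Borel sets, so vanishing over
  boxes propagates to all Borel sets; a function whose integrals over all of them vanish is zero
  almost everywhere.\<close>

theorem tempered_zero:
  fixes G :: "'a::euclidean_space \<Rightarrow> complex"
  assumes G: "tempered G" and zero: "\<And>\<phi>. schwartz \<phi> \<Longrightarrow> (LINT x|lborel. G x * \<phi> x) = 0"
  shows "AE x in lborel. G x = 0"
proof -
  \<comment> \<open>Truncation to growing boxes makes G integrable. The intersection of two boxes is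
    a box, and the integral over the whole space, which the complement step requires, is the one
    over \<open>K n\<close>.\<close>
  define K :: "nat \<Rightarrow> 'a set" where "K n = box (- (real n *\<^sub>R One)) (real n *\<^sub>R One)" for n
  define H where "H n x = indicat_real (K n) x *\<^sub>R G x" for n x
  have H: "integrable lborel (H n)" for n
    unfolding H_def K_def by (intro tempered_indicator_integrable G bounded_box) simp
  have box0: "(LINT x|lborel. indicat_real (box l u) x *\<^sub>R G x) = 0" for l u
    using G zero by (rule tempered_box_integral_zero)
  have "AE x in lborel. H n x = 0" for n
  proof (rule sigma_finite_measure.density_zero[OF lborel.sigma_finite_measure_axioms H])
    fix A :: "'a set" assume "A \<in> sets lborel"
    then have A: "A \<in> sigma_sets UNIV (range (\<lambda>(a, b). box a b :: 'a set))" by (simp add: borel_eq_box)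
    have IS: "Int_stable (range (\<lambda>(a, b). box a b :: 'a set))"
      by (auto simp: Int_stable_def box_Int_box)
    have RP: "range (\<lambda>(a, b). box a b :: 'a set) \<subseteq> Pow UNIV" by simp
    from IS RP A show "set_lebesgue_integral lborel A (H n) = 0"
    proof (induction rule: sigma_sets_induct_disjoint)
      case (basic A)
      then obtain a b where "A = box a b" by auto
      then obtain l u where lu: "A \<inter> K n = box l u" unfolding K_def by (auto simp: box_Int_box)
      have "set_lebesgue_integral lborel A (H n) = (LINT x|lborel. indicat_real (box l u) x *\<^sub>R G x)"
        unfolding set_lebesgue_integral_def H_def lu[symmetric] by (simp add: indicator_inter_arith)
      then show ?case using box0 by simp
    next
      case empty
      then show ?case by (simp add: set_lebesgue_integral_def)
    next
      case (compl A)
      then have A: "A \<in> sets borel" by (simp add: borel_eq_box)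
      then have "set_integrable lborel A (H n)"
        using H by (simp add: set_integrable_def integrable_mult_indicator)
      then have "set_lebesgue_integral lborel UNIV (H n)
          = set_lebesgue_integral lborel A (H n) + set_lebesgue_integral lborel (UNIV - A) (H n)"
        using A H by (subst set_integral_Un[symmetric])
          (auto simp: set_integrable_def integrable_mult_indicator)
      moreover have "set_lebesgue_integral lborel UNIV (H n) = 0"
        using box0 by (simp add: set_lebesgue_integral_def H_def K_def)
      ultimately show ?case using compl by simp
    next
      case (union A)
      then have A: "A i \<in> sets lborel" for i by (auto simp: borel_eq_box)
      have "set_lebesgue_integral lborel (\<Union>i. A i) (H n) = (\<Sum>i. set_lebesgue_integral lborel (A i) (H n))"
        using union(1) A H
        by (intro lebesgue_integral_countable_add)
           (auto simp: disjoint_family_on_def set_integrable_def intro!: integrable_mult_indicator)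
      then show ?case using union by simp
    qed
  qed
  then have "AE x in lborel. \<forall>n. H n x = 0" by (simp add: AE_all_countable)
  then show ?thesis
  proof eventually_elim
    case (elim x)
    have "x \<in> (\<Union>n. K n)" using UN_box_eq_UNIV unfolding K_def by auto
    then show ?case using elim by (auto simp: H_def indicator_def split: if_splits)
  qed
qed

section \<open>Existence and uniqueness of the Fourier transform\<close>

lemma tempered_integrable: "integrable lborel f \<Longrightarrow> tempered f"
  unfolding tempered_def by (intro conjI exI[of _ 0]) auto

lemma tempered_bounded:
  fixes f :: "'a::euclidean_space \<Rightarrow> complex"
  assumes [measurable]: "f \<in> borel_measurable borel" and "\<And>x. cmod (f x) \<le> B"
  shows "tempered f"
proof -
  have "integrable lborel (\<lambda>x::'a. B * (1 / (1 + norm x) ^ (2 * DIM('a))))"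
    by (intro integrable_mult_right integrable_inverse_norm_power)
  then have "integrable lborel (\<lambda>x. f x / of_real ((1 + norm x) ^ (2 * DIM('a))))"
  proof (rule Bochner_Integration.integrable_bound)
    show "AE x in lborel. norm (f x / of_real ((1 + norm x) ^ (2 * DIM('a)))) \<le> norm (B * (1 / (1 + norm x) ^ (2 * DIM('a))))"
      using assms(2) by (intro AE_I2) (auto simp: norm_divide norm_power abs_mult abs_divide
          intro!: divide_right_mono order_trans[OF assms(2) abs_ge_self] simp del: of_real_add of_real_power)
  qed measurable
  then show ?thesis unfolding tempered_def using assms(1) by blast
qed

lemma tempered_diff:
  fixes F1 F2 :: "'a::euclidean_space \<Rightarrow> complex"
  assumes "tempered F1" "tempered F2"
  shows "tempered (\<lambda>x. F1 x - F2 x)"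
proof -
  have *: "integrable lborel (\<lambda>x. F x / of_real ((1 + norm x) ^ (N + M)))"
    if "integrable lborel (\<lambda>x. F x / of_real ((1 + norm x) ^ N))" "F \<in> borel_measurable borel"
    for F :: "'a \<Rightarrow> complex" and N M
  proof (rule Bochner_Integration.integrable_bound[OF that(1)])
    note [measurable] = that(2)
    show "(\<lambda>x. F x / of_real ((1 + norm x) ^ (N + M))) \<in> borel_measurable lborel" by measurable
    have "cmod (F x) / (1 + norm x) ^ (N + M) \<le> cmod (F x) / (1 + norm x) ^ N" for x
      by (intro divide_left_mono power_increasing mult_pos_pos zero_less_power) (auto simp: add_pos_nonneg)
    then show "AE x in lborel. norm (F x / of_real ((1 + norm x) ^ (N + M))) \<le> norm (F x / of_real ((1 + norm x) ^ N))"
      by (intro AE_I2) (simp add: norm_divide norm_power norm_mult del: of_real_add of_real_power)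
  qed
  obtain N M where "integrable lborel (\<lambda>x. F1 x / of_real ((1 + norm x) ^ N))"
      "integrable lborel (\<lambda>x. F2 x / of_real ((1 + norm x) ^ M))"
      and m: "F1 \<in> borel_measurable borel" "F2 \<in> borel_measurable borel"
    using assms unfolding tempered_def by blast
  then have "integrable lborel (\<lambda>x. F1 x / of_real ((1 + norm x) ^ (N + M)))"
      "integrable lborel (\<lambda>x. F2 x / of_real ((1 + norm x) ^ (M + N)))"
    by (blast intro: *)+
  then have "integrable lborel (\<lambda>x. F1 x / of_real ((1 + norm x) ^ (N + M)) - F2 x / of_real ((1 + norm x) ^ (N + M)))"
    by (simp add: add.commute[of M N])
  then have "integrable lborel (\<lambda>x. (F1 x - F2 x) / of_real ((1 + norm x) ^ (N + M)))"
    by (simp only: diff_divide_distrib)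
  then show ?thesis unfolding tempered_def using m by (intro conjI exI) auto
qed

lemma has_fourier_unique:
  assumes "has_fourier f F1" "has_fourier f F2"
  shows "AE x in lborel. F1 x = F2 x"
proof -
  have T: "tempered F1" "tempered F2" using assms by (auto simp: has_fourier_def)
  have "AE x in lborel. F1 x - F2 x = 0"
  proof (rule tempered_zero[OF tempered_diff[OF T]])
    fix \<phi> :: "'a \<Rightarrow> complex" assume \<phi>: "schwartz \<phi>"
    then have "(LINT x|lborel. F1 x * \<phi> x) = (LINT x|lborel. F2 x * \<phi> x)"
      using assms by (simp add: has_fourier_def)
    then show "(LINT x|lborel. (F1 x - F2 x) * \<phi> x) = 0"
      using tempered_mult_schwartz_integrable[OF T(1) \<phi>] tempered_mult_schwartz_integrable[OF T(2) \<phi>]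
      by (simp add: left_diff_distrib)
  qed
  then show ?thesis by simp
qed

text \<open>The multiplication formula, by Fubini. It makes the integral branch of
  \<open>fourier\<close> an instance of \<open>has_fourier\<close>, so that both branches can be
  treated alike.\<close>

lemma has_fourier_integrable:
  assumes f: "integrable lborel f"
  shows "has_fourier f (fourier_int f)"
  unfolding has_fourier_def
proof (intro conjI allI impI)
  have [measurable]: "f \<in> borel_measurable borel" using f by simp
  show "tempered f" using f by (rule tempered_integrable)
  show "tempered (fourier_int f)"
    using fourier_int_norm_le[of f] by (intro tempered_bounded) measurable
  fix \<phi> :: "'a \<Rightarrow> complex" assume \<phi>: "schwartz \<phi>"
  have [measurable]: "\<phi> \<in> borel_measurable borel" using \<phi> by (rule schwartz_measurable)
  have int: "integrable (lborel \<Otimes>\<^sub>M lborel) (\<lambda>(x, z). f x * (cis (- (z \<bullet> x)) * \<phi> z))"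
    by (rule integrable_unimodular[OF integrable_pair_mult[OF _ _ f schwartz_integrable[OF \<phi>]]])
       (auto simp: norm_mult lborel.sigma_finite_measure_axioms)
  have "(LINT x|lborel. f x * fourier_int \<phi> x) = (LINT x|lborel. (LINT z|lborel. f x * (cis (- (z \<bullet> x)) * \<phi> z)))"
    unfolding fourier_int_def integral_mult_right_zero[symmetric] ..
  also have "\<dots> = (LINT z|lborel. (LINT x|lborel. f x * (cis (- (z \<bullet> x)) * \<phi> z)))"
    by (rule lborel_pair.Fubini_integral[OF int, symmetric])
  also have "\<dots> = (LINT z|lborel. fourier_int f z * \<phi> z)"
    unfolding fourier_int_def integral_mult_left_zero[symmetric] by (simp only: mult_ac inner_commute)
  finally show "(LINT x|lborel. f x * fourier_int \<phi> x) = (LINT \<xi>|lborel. fourier_int f \<xi> * \<phi> \<xi>)" .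
qed

text \<open>The gateway to the unspecified choice in \<open>fourier\<close>: any explicit transform
  determines the chosen one up to a null set, and the norms see no more than that.\<close>

theorem has_fourier_fourier:
  assumes "has_fourier f F"
  shows "has_fourier f (fourier f)" "AE \<xi> in lborel. fourier f \<xi> = F \<xi>"
proof -
  show *: "has_fourier f (fourier f)"
    
  proof (cases "integrable lborel f")
    case True
    then show ?thesis by (simp add: fourier_def has_fourier_integrable)
  next
    case False
    then show ?thesis using someI[of "has_fourier f", OF assms] by (simp add: fourier_def)
  qed
  show "AE \<xi> in lborel. fourier f \<xi> = F \<xi>" using * assms by (rule has_fourier_unique)
qed

section \<open>The bilinear map of the squared half-wave\<close>

text \<open>An injective derivative at x gives |y - x| <= n |f y - f x| for y near x, with n
  depending on x. On small pieces with a common n the map has a Lipschitz inverse, which carries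
  null sets to null sets. This stands in for the inverse function theorem.\<close>

lemma negligible_injective_derivative_preimage:
  fixes f :: "'a::euclidean_space \<Rightarrow> 'b::euclidean_space"
  assumes dim: "DIM('b) \<le> DIM('a)" and N: "negligible N"
    and der: "\<And>x. x \<in> S \<Longrightarrow> \<exists>f'. (f has_derivative f') (at x) \<and> inj f'"
  shows "negligible {x \<in> S. f x \<in> N}"
proof -
  define Q where "Q n = {x \<in> S. f x \<in> N \<and>
      (\<forall>y. norm (y - x) < 1 / Suc n \<longrightarrow> norm (y - x) \<le> real (Suc n) * norm (f y - f x))}" for n
  have "negligible (Q n)" for n
  proof (rule locally_negligible_alt[THEN iffD2], rule ballI)
    fix a assume a: "a \<in> Q n"
    \<comment> \<open>Half the radius in \<open>Q n\<close>, so that any two points of U are close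
      enough for the estimate of \<open>Q n\<close>.\<close>
    define U where "U = Q n \<inter> ball a (1 / (2 * Suc n))"
    have U: "x \<in> Q n" "norm (x - a) < 1 / (2 * Suc n)" if "x \<in> U" for x
      using that by (auto simp: U_def dist_norm norm_minus_commute)
    have lip: "norm (y - x) \<le> real (Suc n) * norm (f y - f x)" if "x \<in> U" "y \<in> U" for x y
    proof -
      have "norm (y - x) \<le> norm (y - a) + norm (x - a)"
        using norm_triangle_ineq4[of "y - a" "x - a"] by simp
      also have "\<dots> < 1 / (2 * Suc n) + 1 / (2 * Suc n)" using U(2) that by (intro add_strict_mono) auto
      also have "\<dots> = 1 / Suc n" by (simp add: field_simps)
      finally show ?thesis using U(1)[OF that(1)] unfolding Q_def by blast
    qed
    have inj: "inj_on f U"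
    proof (rule inj_onI)
      fix x y assume "x \<in> U" "y \<in> U" "f x = f y"
      then show "x = y" using lip[of x y] by simp
    qed
    have "negligible (inv_into U f ` (f ` U))"
    proof (rule negligible_locally_Lipschitz_image[OF dim])
      show "negligible (f ` U)" using U(1) by (intro negligible_subset[OF N]) (auto simp: Q_def)
      fix z assume "z \<in> f ` U"
      then obtain x where x: "x \<in> U" "z = f x" by blast
      have "norm (inv_into U f w - inv_into U f z) \<le> real (Suc n) * norm (w - z)" if w: "w \<in> f ` U" for w
      proof -
        obtain y where "y \<in> U" "w = f y" using w by blast
        then show ?thesis using x lip[of x y] inv_into_f_f[OF inj] by metis
      qed
      then show "\<exists>T B. open T \<and> z \<in> T \<and> (\<forall>w\<in>f ` U \<inter> T. norm (inv_into U f w - inv_into U f z) \<le> B * norm (w - z))"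
        by (intro exI[of _ UNIV] exI[of _ "real (Suc n)"] conjI open_UNIV UNIV_I) blast
    qed
    then have "negligible U" using inj by simp
    moreover have "openin (top_of_set (Q n)) U" unfolding U_def by (intro openin_open_Int open_ball)
    ultimately show "\<exists>U. openin (top_of_set (Q n)) U \<and> a \<in> U \<and> negligible U"
      using a by (intro exI[of _ U]) (auto simp: U_def)
  qed
  moreover have "{x \<in> S. f x \<in> N} \<subseteq> (\<Union>n. Q n)"
  proof
    fix x assume x: "x \<in> {x \<in> S. f x \<in> N}"
    then obtain f' where f': "(f has_derivative f') (at x)" "inj f'" using der by blast
    have lin: "linear f'" using f'(1) by (rule has_derivative_linear)
    obtain B where B: "B > 0" "\<And>h. B * norm h \<le> norm (f' h)"
      using linear_inj_bounded_below_pos[OF lin f'(2)] by blast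
    have "B / 2 > 0" using B(1) by simp
    then obtain d where d: "d > 0"
      "\<And>y. norm (y - x) < d \<Longrightarrow> norm (f y - f x - f' (y - x)) \<le> B / 2 * norm (y - x)"
      using f'(1) unfolding has_derivative_at_alt by blast
    \<comment> \<open>Exceeding 1 / d keeps y where the linear approximation holds; 2 / B is the
      constant left after half of the lower bound B is spent on the remainder.\<close>
    obtain n :: nat where n: "real n > max (1 / d) (2 / B)" using reals_Archimedean2 by blast
    have "1 / d < real (Suc n)" and n2: "2 / B \<le> real (Suc n)" using n by simp_all
    then have n1: "1 / real (Suc n) \<le> d" using d(1) by (simp add: field_simps del: of_nat_Suc)
    have "norm (y - x) \<le> real (Suc n) * norm (f y - f x)" if "norm (y - x) < 1 / Suc n" for y
    proof -
      have 1: "B * norm (y - x) \<le> norm (f' (y - x))" by (rule B(2))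
      also have "\<dots> \<le> norm (f y - f x) + norm (f y - f x - f' (y - x))"
        using norm_triangle_ineq4[of "f y - f x" "f y - f x - f' (y - x)"] by simp
      also have "norm (f y - f x - f' (y - x)) \<le> B / 2 * norm (y - x)"
        using that n1 by (intro d(2)) linarith
      finally have "norm (y - x) \<le> 2 / B * norm (f y - f x)"
        using B(1) by (simp add: field_simps)
      also have "\<dots> \<le> real (Suc n) * norm (f y - f x)" by (intro mult_right_mono n2) simp
      finally show ?thesis .
    qed
    then show "x \<in> (\<Union>n. Q n)" using x by (auto simp: Q_def)
  qed
  ultimately show ?thesis
    using negligible_subset[OF negligible_Union_nat[of Q]] by blast
qed

lemma null_sets_lborel_iff_negligible:
  fixes N :: "'a::euclidean_space set"
  assumes "N \<in> sets borel"
  shows "N \<in> null_sets lborel \<longleftrightarrow> negligible N"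
  using assms by (simp add: negligible_iff_null_sets null_sets_completion_iff)

lemma null_sets_lborel_negligible:
  "N \<in> null_sets lborel \<Longrightarrow> negligible (N :: 'a::euclidean_space set)"
  by (metis null_setsD2 null_sets_lborel_iff_negligible sets_lborel)

lemma null_sets_coordinate_preimage:
  fixes Z :: "real set"
  assumes Z: "Z \<in> null_sets lborel" and b: "b \<in> Basis"
  shows "{y :: 'a::euclidean_space. y \<bullet> b \<in> Z} \<in> null_sets lborel"
proof -
  have [measurable]: "Z \<in> sets borel" using Z by auto
  define h :: "'a \<Rightarrow> real \<Rightarrow> ennreal" where "h c = (if c = b then indicator Z else (\<lambda>_. 1))" for c
  have [measurable]: "h c \<in> borel_measurable borel" for c by (cases "c = b") (simp_all add: h_def)
  have meas: "{y :: 'a. y \<bullet> b \<in> Z} \<in> sets borel" by measurable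
  have "emeasure lborel {y :: 'a. y \<bullet> b \<in> Z} = (\<integral>\<^sup>+ y. indicator {y. y \<bullet> b \<in> Z} y \<partial>lborel)"
    using meas by simp
  also have "\<dots> = (\<integral>\<^sup>+ y. (\<Prod>c\<in>Basis. h c (y \<bullet> c)) \<partial>lborel)"
  proof (intro nn_integral_cong)
    fix y :: 'a
    have "(\<Prod>c\<in>Basis. h c (y \<bullet> c)) = (\<Prod>c\<in>Basis. if c = b then indicator Z (y \<bullet> b) else 1)"
      by (intro prod.cong) (auto simp: h_def)
    also have "\<dots> = indicator Z (y \<bullet> b)" using b by simp
    finally show "(indicator {y. y \<bullet> b \<in> Z} y :: ennreal) = (\<Prod>c\<in>Basis. h c (y \<bullet> c))"
      by (simp add: indicator_def)
  qed
  also have "\<dots> = (\<Prod>c\<in>Basis. \<integral>\<^sup>+ s. h c s \<partial>lborel)" by (rule nn_integral_lborel_prod) auto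
  also have "\<dots> = 0"
    using b Z by (intro prod_zero) (auto simp: h_def intro!: bexI[of _ b])
  finally show ?thesis using meas by (intro null_setsI) auto
qed

section \<open>Null sets under the difference map of half-wave frequencies\<close>

definition wave_pair :: "'a::euclidean_space \<times> 'a \<Rightarrow> real \<times> 'a" where
  "wave_pair p = (norm (fst p) - norm (snd p), fst p - snd p)"

lemma wave_pair_measurable[measurable]: "wave_pair \<in> borel \<rightarrow>\<^sub>M borel"
  unfolding wave_pair_def by (intro borel_measurable_continuous_onI continuous_intros)

text \<open>One vanishing 2 x 2 minor, a condition met by every parallel pair, in particular by
  vectors of equal direction, where \<open>wave_pair\<close> is not a submersion. For a fixed first
  vector with nonzero b1-coordinate the slice is a hyperplane.\<close>

lemma parallel_pairs_null:
  assumes "b1 \<in> Basis" "b2 \<in> Basis" "b1 \<noteq> b2"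
  shows "{p :: 'a::euclidean_space \<times> 'a. (fst p \<bullet> b1) * (snd p \<bullet> b2) = (fst p \<bullet> b2) * (snd p \<bullet> b1)}
    \<in> null_sets lborel"
proof -
  let ?Z = "{p :: 'a \<times> 'a. (fst p \<bullet> b1) * (snd p \<bullet> b2) = (fst p \<bullet> b2) * (snd p \<bullet> b1)}"
  have Z: "?Z \<in> sets borel"
    by (intro borel_closed closed_Collect_eq continuous_intros)
  have "{x :: 'a. x \<bullet> b1 = 0} \<in> null_sets lborel"
    using negligible_standard_hyperplane[OF assms(1), of 0]
    by (simp add: null_sets_lborel_iff_negligible borel_closed closed_Collect_eq continuous_intros)
  then have "AE x in lborel. x \<bullet> b1 \<noteq> 0" by (drule_tac AE_not_in) simp
  then have "AE x in lborel. emeasure lborel (Pair x -` ?Z) = 0"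
  proof eventually_elim
    case (elim x)
    let ?a = "(x \<bullet> b1) *\<^sub>R b2 - (x \<bullet> b2) *\<^sub>R b1"
    have "?a \<bullet> b2 = x \<bullet> b1" using assms by (simp add: inner_diff_left inner_Basis)
    then have "?a \<noteq> 0" using elim by auto
    then have "negligible {y. ?a \<bullet> y = 0}" by (intro negligible_hyperplane) auto
    moreover have "Pair x -` ?Z = {y. ?a \<bullet> y = 0}"
      by (auto simp: inner_diff_left inner_commute[of b1] inner_commute[of b2])
    moreover have "{y. ?a \<bullet> y = 0} \<in> sets borel" by (intro borel_closed closed_hyperplane)
    ultimately show ?case by (metis null_sets_lborel_iff_negligible null_setsD1)
  qed
  then have "emeasure (lborel \<Otimes>\<^sub>M lborel) ?Z = 0"
    using Z[folded borel_prod]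
    by (subst lborel.emeasure_pair_measure_alt) (auto cong: nn_integral_cong_AE)
  then show ?thesis using Z by (simp add: lborel_prod null_setsI)
qed

text \<open>For almost every second component the section of N in the first is null, and requiring
  one coordinate of a vector to lie in a null set of reals is a null condition. This lifts N from
  dimension d + 1 to the dimension 2 d of the pairs.\<close>

lemma null_sets_extend:
  fixes N :: "(real \<times> 'a::euclidean_space) set"
  assumes N: "N \<in> null_sets lborel" and b: "b \<in> Basis"
  shows "{p :: 'a \<times> 'a. (fst p \<bullet> b, snd p) \<in> N} \<in> null_sets lborel"
proof -
  have [measurable]: "N \<in> sets borel" using N by auto
  let ?L = "\<lambda>p :: 'a \<times> 'a. (fst p \<bullet> b, snd p)"
  have L: "?L \<in> borel \<rightarrow>\<^sub>M borel" by (intro borel_measurable_continuous_onI continuous_intros)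
  have meas: "{p. ?L p \<in> N} \<in> sets borel" using measurable_sets[OF L, of N] by (simp add: vimage_def)
  have "N \<in> null_sets (lborel \<Otimes>\<^sub>M lborel)" using N by (simp add: lborel_prod)
  then have "AE p in lborel \<Otimes>\<^sub>M lborel. p \<notin> N" by (rule AE_not_in)
  moreover have "{x. x \<notin> N} \<in> sets (borel \<Otimes>\<^sub>M borel)"
    unfolding borel_prod Compl_eq[symmetric] by (intro sets.compl_sets borel_comp) simp
  ultimately have "AE \<xi> in lborel. AE t in lborel. (t, \<xi>) \<notin> N"
    using lborel_pair.AE_pair[of "\<lambda>p. p \<notin> N"] by (subst lborel_pair.AE_commute[symmetric]) (auto simp: lborel_prod)
  then have "AE \<xi> in lborel. emeasure lborel ((\<lambda>y. (y, \<xi>)) -` {p. ?L p \<in> N}) = 0"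
  proof eventually_elim
    case (elim \<xi>)
    have "{t. (t, \<xi>) \<in> N} \<in> sets borel"
      using measurable_sets[of "\<lambda>t. (t, \<xi>)" borel borel N] by (simp add: vimage_def borel_measurable_Pair)
    then have "{t. (t, \<xi>) \<in> N} \<in> null_sets lborel" using elim by (subst AE_iff_null_sets) auto
    from null_sets_coordinate_preimage[OF this b]
    show ?case by (auto simp: vimage_def)
  qed
  then have "emeasure (lborel \<Otimes>\<^sub>M lborel) {p. ?L p \<in> N} = 0"
    using meas[folded borel_prod]
    by (subst lborel_pair.emeasure_pair_measure_alt2) (auto cong: nn_integral_cong_AE)
  then show ?thesis using meas by (simp add: lborel_prod null_setsI)
qed

text \<open>The dimension drops from 2 d to d + 1, so the lemma on injective derivatives applies
  only after d - 1 coordinates are added to the map, and as free coordinates to N. This works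
  wherever the two directions differ; the remaining pairs are parallel or contain zero and form a
  null set once d >= 2.\<close>

theorem wave_pair_null_preimage:
  fixes N :: "(real \<times> 'a::euclidean_space) set"
  assumes dim: "DIM('a) \<ge> 2" and N: "N \<in> null_sets lborel"
  shows "wave_pair -` N \<in> null_sets lborel"
proof -
  obtain b1 b2 :: 'a where b12: "b1 \<in> Basis" "b2 \<in> Basis" "b1 \<noteq> b2"
    using dim by (meson card_2_iff' ex_card subset_iff)
  let ?Z = "{p :: 'a \<times> 'a. (fst p \<bullet> b1) * (snd p \<bullet> b2) = (fst p \<bullet> b2) * (snd p \<bullet> b1)}"
  \<comment> \<open>The difference of the two numbers is the derivative of |eta| - |zeta| when both
    vectors move along b. The vector eta - zeta does not see this motion, so the time component has
    to detect it.\<close>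
  define S where "S b = {p :: 'a \<times> 'a. fst p \<noteq> 0 \<and> snd p \<noteq> 0 \<and> sgn (fst p) \<bullet> b \<noteq> sgn (snd p) \<bullet> b}" for b
  text \<open>The derivative of \<open>wave_pair\<close> is completed to an endomorphism by replacing the coordinate
    \<open>b\<close> of the first argument.\<close>
  define \<Phi> where "\<Phi> b p = (fst p + ((norm (fst p) - norm (snd p)) - fst p \<bullet> b) *\<^sub>R b, fst p - snd p)"
    for b and p :: "'a \<times> 'a"
  have "negligible {p \<in> S b. wave_pair p \<in> N}" if b: "b \<in> Basis" for b
  proof -
    let ?N' = "{p :: 'a \<times> 'a. (fst p \<bullet> b, snd p) \<in> N}"
    have "?N' \<in> null_sets lborel" using N b by (rule null_sets_extend)
    then have N': "negligible ?N'" by (rule null_sets_lborel_negligible)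
    have "negligible {p \<in> S b. \<Phi> b p \<in> ?N'}"
    proof (rule negligible_injective_derivative_preimage[OF _ N'])
      fix p assume p: "p \<in> S b"
      define \<Phi>' where "\<Phi>' h = (fst h + ((sgn (fst p) \<bullet> fst h - sgn (snd p) \<bullet> snd h) - fst h \<bullet> b) *\<^sub>R b,
          fst h - snd h)" for h
      have "(\<Phi> b has_derivative \<Phi>') (at p)"
      proof -
        have 1: "((\<lambda>p :: 'a \<times> 'a. norm (fst p)) has_derivative (\<lambda>h. sgn (fst p) \<bullet> fst h)) (at p)"
          using p by (intro has_derivative_compose[OF has_derivative_fst[OF has_derivative_ident]])
            (auto simp: S_def intro!: has_derivative_eq_rhs[OF has_derivative_norm] simp: inner_commute)
        have 2: "((\<lambda>p :: 'a \<times> 'a. norm (snd p)) has_derivative (\<lambda>h. sgn (snd p) \<bullet> snd h)) (at p)"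
          using p by (intro has_derivative_compose[OF has_derivative_snd[OF has_derivative_ident]])
            (auto simp: S_def intro!: has_derivative_eq_rhs[OF has_derivative_norm] simp: inner_commute)
        show ?thesis unfolding \<Phi>_def \<Phi>'_def
          by (intro has_derivative_Pair has_derivative_add has_derivative_diff has_derivative_scaleR_left
              has_derivative_inner_left has_derivative_fst has_derivative_snd has_derivative_ident 1 2)
      qed
      moreover have "inj \<Phi>'"
      proof -
        have lin: "linear \<Phi>'" using calculation by (rule has_derivative_linear)
        show ?thesis unfolding linear_injective_0[OF lin]
        proof (intro allI impI)
          fix h assume h: "\<Phi>' h = 0"
          then have eq: "snd h = fst h" by (simp add: \<Phi>'_def zero_prod_def)
          define s where "s = (sgn (fst p) \<bullet> fst h - sgn (snd p) \<bullet> snd h) - fst h \<bullet> b"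
          have "fst (\<Phi>' h) = 0" using h by simp
          then have "fst h + s *\<^sub>R b = 0" by (simp only: \<Phi>'_def s_def fst_conv)
          then have fh: "fst h = - s *\<^sub>R b" by (simp add: eq_neg_iff_add_eq_0)
          \<comment> \<open>Both halves of h equal - s b; inserting this into the definition of s
            leaves s times the bracket equal to 0, and the bracket is nonzero on
            \<open>S b\<close>.\<close>
          have "s = - s * (sgn (fst p) \<bullet> b - sgn (snd p) \<bullet> b) + s"
            using b by (subst s_def) (simp add: eq fh algebra_simps)
          then have "s = 0" using p by (simp add: S_def)
          then show "h = 0" using fh eq by (simp add: prod_eq_iff)
        qed
      qed
      ultimately show "\<exists>f'. (\<Phi> b has_derivative f') (at p) \<and> inj f'" by blast
    qed simp
    moreover have "\<Phi> b p \<in> ?N' \<longleftrightarrow> wave_pair p \<in> N" for p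
      using b by (simp add: \<Phi>_def wave_pair_def inner_add_left)
    ultimately show ?thesis by simp
  qed
  then have "negligible (\<Union>b\<in>Basis. {p \<in> S b. wave_pair p \<in> N})" by (intro negligible_Union) auto
  moreover have "negligible ?Z"
    using parallel_pairs_null[OF b12] by (rule null_sets_lborel_negligible)
  ultimately have "negligible ((\<Union>b\<in>Basis. {p \<in> S b. wave_pair p \<in> N}) \<union> ?Z)" by (rule negligible_Un)
  moreover have "wave_pair -` N \<subseteq> (\<Union>b\<in>Basis. {p \<in> S b. wave_pair p \<in> N}) \<union> ?Z"
  proof
    fix p assume p: "p \<in> wave_pair -` N"
    show "p \<in> (\<Union>b\<in>Basis. {p \<in> S b. wave_pair p \<in> N}) \<union> ?Z"
    proof (cases "\<exists>b\<in>Basis. p \<in> S b")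
      case True
      then show ?thesis using p by auto
    next
      case False
      then have "fst p = 0 \<or> snd p = 0 \<or> sgn (fst p) = sgn (snd p)"
        by (auto simp: S_def euclidean_eq_iff[of "sgn (fst p)"])
      moreover have "p \<in> ?Z" if "sgn (fst p) = sgn (snd p)"
      proof -
        have sgn: "x = norm x *\<^sub>R sgn x" for x :: 'a by (cases "x = 0") (auto simp: sgn_div_norm)
        have "fst p = norm (fst p) *\<^sub>R sgn (fst p)" "snd p = norm (snd p) *\<^sub>R sgn (fst p)"
          using sgn[of "fst p"] sgn[of "snd p"] unfolding that by simp_all
        then obtain v where "fst p = norm (fst p) *\<^sub>R v" "snd p = norm (snd p) *\<^sub>R v" by blast
        then have "fst p \<bullet> b = norm (fst p) * (v \<bullet> b)" "snd p \<bullet> b = norm (snd p) * (v \<bullet> b)" for b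
          by (metis inner_scaleR_left)+
        then show ?thesis by (simp add: mult_ac)
      qed
      ultimately show ?thesis by auto
    qed
  qed
  ultimately have "negligible (wave_pair -` N)" by (rule negligible_subset)
  moreover have "wave_pair -` N \<in> sets borel"
    using measurable_sets[OF wave_pair_measurable, of N] N by auto
  ultimately show ?thesis by (simp add: null_sets_lborel_iff_negligible)
qed

section \<open>Wave packets with indicator Fourier transform\<close>

definition wave_packet :: "'a::euclidean_space set \<Rightarrow> 'a \<Rightarrow> complex" where
  "wave_packet P x = of_real ((2 * pi) powr - real DIM('a)) * (LINT \<xi>|lborel. cis (x \<bullet> \<xi>) * indicator P \<xi>)"

definition packet_density :: "'a::euclidean_space set \<Rightarrow> real \<times> 'a \<Rightarrow> complex" where
  "packet_density P = (\<lambda>p. of_real ((cmod (halfwave (wave_packet P) p))\<^sup>2))"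

lemma integrable_indicator_complex:
  assumes "P \<in> sets M" "emeasure M P < \<infinity>"
  shows "integrable M (\<lambda>x. indicator P x :: complex)"
  using integrable_of_real[OF integrable_real_indicator[OF assms], where 'a=complex]
  by (simp add: of_real_indicator)

lemma power_mult_powr_minus: "a ^ n * a powr - real n = 1" if "a > 0" for a :: real
  using that by (simp add: powr_minus powr_realpow)

lemma superposition_norm_le:
  fixes g :: "'b \<Rightarrow> complex"
  shows "cmod (LINT m|M. cis (x \<bullet> T m) * g m) \<le> (LINT m|M. cmod (g m))"
  using integral_norm_bound[of M "\<lambda>m. cis (x \<bullet> T m) * g m"] by (simp add: norm_mult)

lemma superposition_measurable:
  fixes g :: "'b \<Rightarrow> complex" and T :: "'b \<Rightarrow> 'a::euclidean_space"
  assumes "sigma_finite_measure M" and [measurable]: "g \<in> borel_measurable M" "T \<in> M \<rightarrow>\<^sub>M borel"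
  shows "(\<lambda>x. LINT m|M. cis (x \<bullet> T m) * g m) \<in> borel_measurable borel"
proof -
  interpret sigma_finite_measure M by fact
  show ?thesis by (rule borel_measurable_lebesgue_integral) measurable
qed

lemma tempered_superposition:
  fixes g :: "'b \<Rightarrow> complex" and T :: "'b \<Rightarrow> 'a::euclidean_space"
  assumes "sigma_finite_measure M" "g \<in> borel_measurable M" "T \<in> M \<rightarrow>\<^sub>M borel"
  shows "tempered (\<lambda>x. LINT m|M. cis (x \<bullet> T m) * g m)"
  using superposition_measurable[OF assms] superposition_norm_le by (rule tempered_bounded)

context
  fixes P :: "'a::euclidean_space set"
  assumes P[measurable]: "P \<in> sets borel" and P_finite: "emeasure lborel P < \<infinity>"
begin

text \<open>The superposition formula with T the identity; the normalisation of the packet cancels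
  the (2 pi)^d of inversion. The distributional sense is essential: the indicator of a nondegenerate
  plate is discontinuous, so its packet is not integrable.\<close>

lemma has_fourier_wave_packet: "has_fourier (wave_packet P) (indicator P)"
  unfolding has_fourier_def
proof (intro conjI allI impI)
  have int: "integrable lborel (\<lambda>x. indicator P x :: complex)"
    using P_finite by (intro integrable_indicator_complex) auto
  then show "tempered (indicator P)" by (rule tempered_integrable)
  let ?c = "complex_of_real ((2 * pi) powr - real DIM('a))"
  have wp: "wave_packet P = (\<lambda>x. LINT \<xi>|lborel. cis (x \<bullet> \<xi>) * (?c * indicator P \<xi>))"
    unfolding wave_packet_def integral_mult_right_zero[symmetric] by (simp only: mult_ac)
  show "tempered (wave_packet P)"
    unfolding wp by (rule tempered_superposition) (auto simp: lborel.sigma_finite_measure_axioms)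
  fix \<phi> :: "'a \<Rightarrow> complex" assume \<phi>: "schwartz \<phi>"
  have "(LINT x|lborel. wave_packet P x * fourier_int \<phi> x)
      = of_real ((2 * pi) ^ DIM('a)) * (LINT \<xi>|lborel. ?c * indicator P \<xi> * \<phi> \<xi>)"
    unfolding wp using int
    by (intro fourier_inversion_superposition \<phi> integrable_mult_right) (auto simp: lborel.sigma_finite_measure_axioms)
  also have "\<dots> = of_real ((2 * pi) ^ DIM('a)) * ?c * (LINT \<xi>|lborel. indicator P \<xi> * \<phi> \<xi>)"
    by (simp only: mult.assoc integral_mult_right_zero)
  also have "of_real ((2 * pi) ^ DIM('a)) * ?c = 1"
    unfolding of_real_mult[symmetric] by (subst power_mult_powr_minus) auto
  finally show "(LINT x|lborel. wave_packet P x * fourier_int \<phi> x) = (LINT \<xi>|lborel. indicator P \<xi> * \<phi> \<xi>)"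
    by simp
qed

lemma fourier_wave_packet:
  shows "has_fourier (wave_packet P) (fourier (wave_packet P))"
    and AE_fourier_wave_packet: "AE \<xi> in lborel. fourier (wave_packet P) \<xi> = indicator P \<xi>"
  using has_fourier_fourier[OF has_fourier_wave_packet] by auto

lemma fourier_wave_packet_measurable[measurable]: "fourier (wave_packet P) \<in> borel_measurable borel"
  using fourier_wave_packet by (auto simp: has_fourier_def tempered_def)

text \<open>The transform chosen by \<open>fourier\<close> agrees with the indicator almost
  everywhere and is therefore integrable, so the propagator is given by its integral branch.\<close>

lemma halfwave_wave_packet:
  "halfwave (wave_packet P) (t, x) = of_real ((2 * pi) powr - real DIM('a)) *
     (LINT \<xi>|lborel. cis (x \<bullet> \<xi> + t * norm \<xi>) * indicator P \<xi>)"
proof -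
  have "integrable lborel (\<lambda>x. indicator P x :: complex)"
    using P_finite by (intro integrable_indicator_complex) auto
  then have "integrable lborel (fourier (wave_packet P))"
    using AE_fourier_wave_packet by (subst integrable_cong_AE) auto
  moreover have "(LINT \<xi>|lborel. cis (x \<bullet> \<xi>) * cis (t * norm \<xi>) * fourier (wave_packet P) \<xi>)
      = (LINT \<xi>|lborel. cis (x \<bullet> \<xi> + t * norm \<xi>) * indicator P \<xi>)"
  proof (rule integral_cong_AE)
    show "AE \<xi> in lborel. cis (x \<bullet> \<xi>) * cis (t * norm \<xi>) * fourier (wave_packet P) \<xi>
        = cis (x \<bullet> \<xi> + t * norm \<xi>) * indicator P \<xi>"
      using AE_fourier_wave_packet by eventually_elim (simp add: cis_mult)
  qed measurable
  ultimately show ?thesis by (simp add: halfwave_def)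
qed

text \<open>The squared modulus is u times its conjugate, a double integral in which the two phases
  subtract to \<open>p \<bullet> wave_pair q\<close>.\<close>

lemma packet_density_superposition:
  "packet_density P p = (LINT q|lborel. cis (p \<bullet> wave_pair q) *
     (of_real (((2 * pi) powr - real DIM('a))\<^sup>2) * indicator (P \<times> P) q))"
proof (cases p)
  case (Pair t x)
  define c where "c = complex_of_real ((2 * pi) powr - real DIM('a))"
  define a :: "'a \<Rightarrow> complex" where "a \<xi> = cis (x \<bullet> \<xi> + t * norm \<xi>) * indicator P \<xi>" for \<xi>
  have int: "integrable lborel a"
    unfolding a_def using P_finite by (intro cis_integrable integrable_indicator_complex) auto
  then have int': "integrable lborel (\<lambda>\<zeta>. cnj (a \<zeta>))" by simp
  have int2: "integrable (lborel \<Otimes>\<^sub>M lborel) (\<lambda>(\<eta>, \<zeta>). a \<eta> * cnj (a \<zeta>))"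
    by (rule integrable_pair_mult[OF _ _ int int']) (auto simp: lborel.sigma_finite_measure_axioms)
  have cnj_c: "cnj c = c" by (simp add: c_def)
  have "packet_density P p = halfwave (wave_packet P) p * cnj (halfwave (wave_packet P) p)"
    by (simp add: packet_density_def complex_norm_square del: of_real_power)
  also have "\<dots> = c\<^sup>2 * ((LINT \<eta>|lborel. a \<eta>) * (LINT \<zeta>|lborel. cnj (a \<zeta>)))"
    unfolding Pair halfwave_wave_packet a_def[symmetric] c_def[symmetric]
    by (simp add: cnj_c power2_eq_square)
  also have "(LINT \<eta>|lborel. a \<eta>) * (LINT \<zeta>|lborel. cnj (a \<zeta>)) = (LINT \<eta>|lborel. (LINT \<zeta>|lborel. a \<eta> * cnj (a \<zeta>)))"
    by (simp only: integral_mult_left_zero integral_mult_right_zero)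
  also have "\<dots> = (LINT q|(lborel \<Otimes>\<^sub>M lborel). (case q of (\<eta>, \<zeta>) \<Rightarrow> a \<eta> * cnj (a \<zeta>)))"
    using lborel_pair.integral_fst'[OF int2] by simp
  also have "c\<^sup>2 * \<dots> = (LINT q|lborel. c\<^sup>2 * (case q of (\<eta>, \<zeta>) \<Rightarrow> a \<eta> * cnj (a \<zeta>)))"
    by (simp add: lborel_prod)
  also have "\<dots> = (LINT q|lborel. cis (p \<bullet> wave_pair q) * (c\<^sup>2 * indicator (P \<times> P) q))"
  proof (rule Bochner_Integration.integral_cong[OF refl])
    fix q :: "'a \<times> 'a"
    obtain \<eta> \<zeta> where q: "q = (\<eta>, \<zeta>)" by fastforce
    have "cis (x \<bullet> \<eta> + t * norm \<eta>) * cnj (cis (x \<bullet> \<zeta> + t * norm \<zeta>)) = cis (p \<bullet> wave_pair q)"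
      by (simp add: cis_cnj cis_mult q Pair wave_pair_def algebra_simps)
    then have "a \<eta> * cnj (a \<zeta>) = cis (p \<bullet> wave_pair q) * (indicator P \<eta> * indicator P \<zeta>)"
      by (simp add: a_def indicator_def)
    then show "c\<^sup>2 * (case q of (\<eta>, \<zeta>) \<Rightarrow> a \<eta> * cnj (a \<zeta>))
        = cis (p \<bullet> wave_pair q) * (c\<^sup>2 * indicator (P \<times> P) q)"
      by (simp add: q indicator_times)
  qed
  finally show ?thesis by (simp add: c_def)
qed

text \<open>The last clause is the only access to D: its integral over E measures the pairs of
  frequencies that land in E. The constant collects (2 pi)^(d+1) from inversion on space-time and
  one normalisation factor from each of the two half-waves.\<close>

theorem fourier_packet_density:
  assumes dim: "DIM('a) \<ge> 2"
  obtains D :: "real \<times> 'a \<Rightarrow> real"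
  where "D \<in> borel_measurable borel" "\<And>p. D p \<ge> 0"
    "AE p in lborel. fourier (packet_density P) p
       = of_real ((2 * pi) ^ (DIM('a) + 1) * ((2 * pi) powr - real DIM('a))\<^sup>2 * D p)"
    "\<And>E. E \<in> sets borel \<Longrightarrow>
       (\<integral>\<^sup>+ p. ennreal (D p) * indicator E p \<partial>lborel) = emeasure lborel (P \<times> P \<inter> wave_pair -` E)"
proof -
  let ?c2 = "((2 * pi) powr - real DIM('a))\<^sup>2"
  define \<nu> where "\<nu> = density lborel (indicator (P \<times> P) :: 'a \<times> 'a \<Rightarrow> ennreal)"
  define \<mu> where "\<mu> = distr \<nu> borel (wave_pair :: 'a \<times> 'a \<Rightarrow> real \<times> 'a)"
  have PP[measurable]: "P \<times> P \<in> sets borel"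
    using P by (intro borel_Times) auto
  have PPfin: "emeasure lborel (P \<times> P) < \<infinity>"
    using P_finite lborel.emeasure_pair_measure_Times[of P lborel P]
    by (simp add: lborel_prod ennreal_mult_less_top)
  have meas\<nu>: "wave_pair \<in> \<nu> \<rightarrow>\<^sub>M borel" by (simp add: \<nu>_def)
  have emu: "emeasure \<mu> E = emeasure lborel (P \<times> P \<inter> wave_pair -` E)" if E: "E \<in> sets borel" for E
  proof -
    have *: "wave_pair -` E \<in> sets borel" using measurable_sets[OF wave_pair_measurable E] by simp
    have "emeasure \<mu> E = emeasure \<nu> (wave_pair -` E)"
      unfolding \<mu>_def using E by (subst emeasure_distr[OF meas\<nu>]) (auto simp: \<nu>_def)
    also have "\<dots> = (\<integral>\<^sup>+ q. indicator (P \<times> P) q * indicator (wave_pair -` E) q \<partial>lborel)"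
      unfolding \<nu>_def using * by (subst emeasure_density) auto
    also have "\<dots> = (\<integral>\<^sup>+ q. indicator (P \<times> P \<inter> wave_pair -` E) q \<partial>lborel)"
      by (simp add: indicator_inter_arith)
    finally show ?thesis using * PP by (simp add: nn_integral_indicator)
  qed
  have "finite_measure \<mu>"
  proof
    show "emeasure \<mu> (space \<mu>) \<noteq> \<infinity>"
      using emu[of UNIV] PPfin by (simp add: \<mu>_def)
  qed
  moreover have ac: "absolutely_continuous lborel \<mu>"
    unfolding absolutely_continuous_def
  proof
    fix N :: "(real \<times> 'a) set" assume N: "N \<in> null_sets lborel"
    from wave_pair_null_preimage[OF dim this]
    have "emeasure lborel (P \<times> P \<inter> wave_pair -` N) = 0"
      by (metis Int_commute PP null_setsD1 null_set_Int1 sets_lborel)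
    then show "N \<in> null_sets \<mu>" using emu[of N] N by (auto simp: \<mu>_def null_sets_def)
  qed
  moreover have sets: "sets \<mu> = sets lborel" by (simp add: \<mu>_def)
  \<comment> \<open>Finiteness of the image measure permits a real-valued derivative, which can be
    embedded in the complex numbers.\<close>
  ultimately obtain D where D: "D \<in> borel_measurable lborel" "AE p in lborel. RN_deriv lborel \<mu> p = ennreal (D p)"
      "\<And>p. 0 \<le> D p"
    using sigma_finite_measure.real_RN_deriv[OF lborel.sigma_finite_measure_axioms, of \<mu>] by blast
  have [measurable]: "D \<in> borel_measurable borel" using D(1) by simp
  have "density lborel (\<lambda>p. ennreal (D p)) = density lborel (RN_deriv lborel \<mu>)"
    using D(2) by (intro density_cong) auto
  also have "\<dots> = \<mu>" using ac sets by (rule sigma_finite_measure.density_RN_deriv[OF lborel.sigma_finite_measure_axioms])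
  finally have dens: "density lborel (\<lambda>p. ennreal (D p)) = \<mu>" .
  have ED: "(\<integral>\<^sup>+ p. ennreal (D p) * indicator E p \<partial>lborel) = emeasure lborel (P \<times> P \<inter> wave_pair -` E)"
    if E: "E \<in> sets borel" for E
  proof -
    have "emeasure \<mu> E = (\<integral>\<^sup>+ p. ennreal (D p) * indicator E p \<partial>lborel)"
      unfolding dens[symmetric] using E by (subst emeasure_density) auto
    then show ?thesis using emu[OF E] by simp
  qed
  have Dint: "integrable lborel D"
    using D(3) ED[of UNIV] PPfin by (intro integrableI_nonneg) auto
  define K where "K = (2 * pi) ^ (DIM('a) + 1) * ?c2"
  have gint: "integrable lborel (\<lambda>q. complex_of_real ?c2 * indicator (P \<times> P) q)"
    using PPfin by (intro integrable_mult_right integrable_indicator_complex) auto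
  have "has_fourier (packet_density P) (\<lambda>p. of_real (K * D p))"
    unfolding has_fourier_def
  proof (intro conjI allI impI)
    show "tempered (\<lambda>p. complex_of_real (K * D p))"
      using Dint by (intro tempered_integrable integrable_of_real integrable_mult_right)
    have pd: "packet_density P = (\<lambda>p. LINT q|lborel. cis (p \<bullet> wave_pair q) *
        (of_real ?c2 * indicator (P \<times> P) q))"
      using packet_density_superposition by (rule ext)
    show "tempered (packet_density P)"
      unfolding pd using gint by (intro tempered_superposition) (auto simp: lborel.sigma_finite_measure_axioms)
    fix \<phi> :: "real \<times> 'a \<Rightarrow> complex" assume \<phi>: "schwartz \<phi>"
    have [measurable]: "\<phi> \<in> borel_measurable borel" using \<phi> by (rule schwartz_measurable)
    have "(LINT q|lborel. indicator (P \<times> P) q * \<phi> (wave_pair q)) = (LINT q|\<nu>. \<phi> (wave_pair q))"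
    proof -
      have nu: "\<nu> = density lborel (\<lambda>q. ennreal (indicat_real (P \<times> P) q))"
        unfolding \<nu>_def by (intro density_cong) (auto simp: indicator_def)
      have m: "(\<lambda>q. \<phi> (wave_pair q)) \<in> borel_measurable lborel" by simp
      show ?thesis
        unfolding nu using m PP
        by (subst integral_density) (auto simp: scaleR_conv_of_real of_real_indicator)
    qed
    also have "\<dots> = (LINT p|\<mu>. \<phi> p)"
      unfolding \<mu>_def by (rule integral_distr[symmetric, OF meas\<nu>]) simp
    also have "\<dots> = (LINT p|lborel. D p *\<^sub>R \<phi> p)"
      unfolding dens[symmetric] using D(3) by (intro integral_density) auto
    finally have eq: "(LINT q|lborel. indicator (P \<times> P) q * \<phi> (wave_pair q)) = (LINT p|lborel. D p *\<^sub>R \<phi> p)" .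
    have "(LINT p|lborel. packet_density P p * fourier_int \<phi> p)
        = of_real ((2 * pi) ^ DIM(real \<times> 'a)) * (LINT q|lborel. of_real ?c2 * indicator (P \<times> P) q * \<phi> (wave_pair q))"
      unfolding pd using gint
      by (intro fourier_inversion_superposition \<phi>) (auto simp: lborel.sigma_finite_measure_axioms)
    also have "\<dots> = of_real ((2 * pi) ^ (DIM('a) + 1)) * (of_real ?c2 * (LINT p|lborel. D p *\<^sub>R \<phi> p))"
      by (simp only: mult.assoc integral_mult_right_zero eq DIM_prod DIM_real add.commute)
    also have "\<dots> = of_real K * (LINT p|lborel. D p *\<^sub>R \<phi> p)"
      by (simp only: K_def of_real_mult mult.assoc)
    also have "\<dots> = (LINT p|lborel. of_real (K * D p) * \<phi> p)"
      unfolding integral_mult_right_zero[symmetric] by (simp only: scaleR_conv_of_real of_real_mult mult.assoc)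
    finally show "(LINT p|lborel. packet_density P p * fourier_int \<phi> p) = (LINT p|lborel. of_real (K * D p) * \<phi> p)" .
  qed
  from has_fourier_fourier(2)[OF this]
  have "AE p in lborel. fourier (packet_density P) p = of_real (K * D p)" .
  then show ?thesis
    using that[of D] D(3) ED unfolding K_def by simp
qed

end

section \<open>Knapp plates\<close>

text \<open>The sign of the exponent is unknown in both applications, 2 s and - 2 beta, so both
  endpoint values enter.\<close>

lemma powr_between:
  fixes a c x C :: real
  assumes "0 < c" "c \<le> x" "x \<le> C"
  shows "min (c powr a) (C powr a) \<le> x powr a" "x powr a \<le> max (c powr a) (C powr a)"
proof -
  have "c powr a \<le> x powr a \<and> x powr a \<le> C powr a \<or> C powr a \<le> x powr a \<and> x powr a \<le> c powr a"
  proof (cases "a \<ge> 0")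
    case True
    then show ?thesis using assms by (intro disjI1 conjI powr_mono2) auto
  next
    case False
    then show ?thesis using assms by (intro disjI2 conjI powr_mono2') auto
  qed
  then show "min (c powr a) (C powr a) \<le> x powr a" "x powr a \<le> max (c powr a) (C powr a)" by auto
qed

text \<open>On E the function D is the product of \<open>q p powr \<beta> * D p\<close> and
  \<open>q p powr (- \<beta>)\<close>; the square of the second factor is at most the larger of the
  two endpoint values.\<close>

lemma weighted_Cauchy_Schwarz:
  fixes D q :: "'a \<Rightarrow> real"
  assumes [measurable]: "D \<in> borel_measurable M" "q \<in> borel_measurable M" "E \<in> sets M"
    and D: "\<And>p. D p \<ge> 0" and q: "\<And>p. p \<in> E \<Longrightarrow> c \<le> q p \<and> q p \<le> C" and c: "c > 0"
  shows "(\<integral>\<^sup>+ p. ennreal (D p) * indicator E p \<partial>M)\<^sup>2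
    \<le> (\<integral>\<^sup>+ p. ennreal ((q p powr \<beta> * D p)\<^sup>2) \<partial>M)
      * (ennreal (max (c powr (- 2 * \<beta>)) (C powr (- 2 * \<beta>))) * emeasure M E)"
proof -
  define B where "B = max (c powr (- 2 * \<beta>)) (C powr (- 2 * \<beta>))"
  define f where "f p = ennreal (q p powr \<beta> * D p)" for p
  define g where "g p = ennreal (q p powr (- \<beta>)) * indicator E p" for p
  have fg: "f p * g p = ennreal (D p) * indicator E p" for p
  proof (cases "p \<in> E")
    case True
    then have "q p > 0" using q c by force
    then have "q p powr \<beta> * D p * q p powr (- \<beta>) = D p" by (simp add: powr_minus)
    then show ?thesis using True D by (simp add: f_def g_def ennreal_mult[symmetric])
  qed (simp add: g_def)
  have "(\<integral>\<^sup>+ p. ennreal (D p) * indicator E p \<partial>M)\<^sup>2 = (\<integral>\<^sup>+ p. f p * g p \<partial>M)\<^sup>2"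
    by (simp only: fg)
  also have "\<dots> \<le> (\<integral>\<^sup>+ p. (f p)\<^sup>2 \<partial>M) * (\<integral>\<^sup>+ p. (g p)\<^sup>2 \<partial>M)"
    by (rule Cauchy_Schwarz_nn_integral) (simp_all add: f_def[abs_def] g_def[abs_def])
  also have "(\<integral>\<^sup>+ p. (g p)\<^sup>2 \<partial>M) \<le> (\<integral>\<^sup>+ p. ennreal B * indicator E p \<partial>M)"
  proof (intro nn_integral_mono)
    fix p
    show "(g p)\<^sup>2 \<le> ennreal B * indicator E p"
    proof (cases "p \<in> E")
      case True
      then have pos: "q p > 0" using q c by force
      have "(q p powr (- \<beta>))\<^sup>2 = q p powr (- 2 * \<beta>)"
        using pos by (simp add: power2_eq_square powr_add[symmetric])
      also have "\<dots> \<le> B" unfolding B_def using q[OF True] c by (intro powr_between) auto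
      finally show ?thesis using True by (simp add: g_def ennreal_power ennreal_leI)
    qed (simp add: g_def)
  qed
  also have "\<dots> = ennreal B * emeasure M E" by (simp add: nn_integral_cmult_indicator)
  finally show ?thesis
    using D by (simp add: f_def ennreal_power B_def mult_left_mono)
qed

section \<open>Plates and the Knapp region\<close>

definition plate :: "'n::finite \<Rightarrow> real \<Rightarrow> real \<Rightarrow> real \<Rightarrow> real \<Rightarrow> (real ^ 'n) set" where
  "plate k l u a b = {\<eta>. l \<le> \<eta> $ k \<and> \<eta> $ k \<le> u \<and> (\<forall>j. j \<noteq> k \<longrightarrow> a \<le> \<eta> $ j \<and> \<eta> $ j \<le> b)}"

lemma plate_eq_cbox:
  "plate k l u a b = cbox (\<chi> i. if i = k then l else a) (\<chi> i. if i = k then u else b)"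
  by (auto simp: plate_def mem_box_cart; metis)

lemma plate_sets[measurable]: "plate k l u a b \<in> sets borel"
  by (simp add: plate_eq_cbox)

lemma emeasure_plate:
  fixes k :: "'n::finite"
  assumes "l \<le> u" "a \<le> b"
  shows "emeasure lborel (plate k l u a b) = ennreal ((u - l) * (b - a) ^ (CARD('n) - 1))"
proof -
  let ?L = "(\<chi> i. if i = k then l else a) :: real ^ 'n" and ?U = "(\<chi> i. if i = k then u else b) :: real ^ 'n"
  have ne: "cbox ?L ?U \<noteq> {}" using assms by (auto simp: interval_ne_empty_cart)
  have "measure lborel (cbox ?L ?U) = (\<Prod>i\<in>UNIV. ?U $ i - ?L $ i)"
    using ne by (rule content_cbox_cart)
  also have "\<dots> = (?U $ k - ?L $ k) * (\<Prod>i\<in>UNIV - {k}. ?U $ i - ?L $ i)"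
    by (rule prod.remove) auto
  also have "(\<Prod>i\<in>UNIV - {k}. ?U $ i - ?L $ i) = (\<Prod>i\<in>UNIV - {k}. b - a)"
    by (intro prod.cong) auto
  finally have "measure lborel (cbox ?L ?U) = (u - l) * (b - a) ^ (CARD('n) - 1)" by simp
  then show ?thesis
    unfolding plate_eq_cbox
    using emeasure_eq_ennreal_measure[of lborel "cbox ?L ?U"] emeasure_lborel_cbox_finite[of ?L ?U] by simp
qed

text \<open>The transverse coordinates add at most 16 n e^2 to the squared norm. Since eta_k >= 1,
  an error of 2 delta in the square becomes an error of delta in the norm, whence the 8.\<close>

lemma norm_plate:
  fixes \<eta> :: "real ^ 'n"
  assumes \<eta>: "\<eta> \<in> plate k 1 2 0 (4 * e)"
  shows "\<eta> $ k \<le> norm \<eta>" "norm \<eta> \<le> \<eta> $ k + 8 * real CARD('n) * e\<^sup>2"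
proof -
  let ?\<delta> = "8 * real CARD('n) * e\<^sup>2"
  have k: "1 \<le> \<eta> $ k" using \<eta> by (simp add: plate_def)
  show "\<eta> $ k \<le> norm \<eta>" using component_le_norm_cart[of \<eta> k] by linarith
  have "(norm \<eta>)\<^sup>2 = (\<Sum>i\<in>UNIV. (\<eta> $ i)\<^sup>2)"
    unfolding power2_norm_eq_inner inner_vec_def by (simp add: power2_eq_square)
  also have "\<dots> = (\<eta> $ k)\<^sup>2 + (\<Sum>i\<in>UNIV - {k}. (\<eta> $ i)\<^sup>2)" by (rule sum.remove) auto
  also have "(\<Sum>i\<in>UNIV - {k}. (\<eta> $ i)\<^sup>2) \<le> (\<Sum>i\<in>UNIV - {k}. (4 * e)\<^sup>2)"
    using \<eta> by (intro sum_mono power_mono) (auto simp: plate_def)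
  also have "\<dots> \<le> (\<Sum>i\<in>(UNIV :: 'n set). (4 * e)\<^sup>2)" by (intro sum_mono2) auto
  also have "\<dots> = 2 * ?\<delta>" by (simp add: power_mult_distrib)
  also have "(\<eta> $ k)\<^sup>2 + 2 * ?\<delta> \<le> (\<eta> $ k)\<^sup>2 + 2 * (\<eta> $ k * ?\<delta>)"
    using mult_right_mono[OF k, of ?\<delta>] by simp
  also have "\<dots> \<le> (\<eta> $ k + ?\<delta>)\<^sup>2"
    using zero_le_power2[of ?\<delta>] by (simp add: power2_sum algebra_simps)
  finally have "(norm \<eta>)\<^sup>2 \<le> (\<eta> $ k + ?\<delta>)\<^sup>2" by simp
  then show "norm \<eta> \<le> \<eta> $ k + ?\<delta>" by (rule power2_le_imp_le) (use k in simp)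
qed

text \<open>A neighbourhood of a piece of a hyperplane tangent to the cone: thickness e^2 in time
  and width e in d - 1 directions. The null form is bounded on both sides so that its powers are
  controlled for either sign of beta; 25 and 72 are the constants that
  \<open>wave_pair_plates\<close> delivers.\<close>

definition knapp_region :: "'n::finite \<Rightarrow> real \<Rightarrow> (real \<times> (real ^ 'n)) set" where
  "knapp_region k e = {p. \<bar>fst p - snd p $ k\<bar> \<le> 8 * real CARD('n) * e\<^sup>2 \<and> snd p \<in> plate k (- 1) 1 (- 4 * e) (4 * e)
     \<and> e\<^sup>2 / 25 \<le> \<bar>(fst p)\<^sup>2 - (norm (snd p))\<^sup>2\<bar> \<and> \<bar>(fst p)\<^sup>2 - (norm (snd p))\<^sup>2\<bar> \<le> 72 * real CARD('n) * e\<^sup>2}"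

lemma knapp_region_sets:
  fixes k :: "'n::finite"
  shows "knapp_region k e \<in> sets borel"
proof -
  have "knapp_region k e = {p. \<bar>fst p - snd p $ k\<bar> \<le> 8 * real CARD('n) * e\<^sup>2} \<inter> snd -` plate k (- 1) 1 (- 4 * e) (4 * e)
     \<inter> {p. e\<^sup>2 / 25 \<le> \<bar>(fst p)\<^sup>2 - (norm (snd p))\<^sup>2\<bar>} \<inter> {p. \<bar>(fst p)\<^sup>2 - (norm (snd p))\<^sup>2\<bar> \<le> 72 * real CARD('n) * e\<^sup>2}"
    by (auto simp: knapp_region_def)
  then show ?thesis
    unfolding plate_eq_cbox
    by (auto intro!: borel_closed closed_Int closed_Collect_le closed_vimage_snd continuous_intros)
qed

lemma emeasure_knapp_region:
  fixes k :: "'n::finite"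
  assumes e: "e > 0"
  shows "emeasure lborel (knapp_region k e)
    \<le> ennreal (16 * real CARD('n) * e\<^sup>2 * (2 * (8 * e) ^ (CARD('n) - 1)))"
proof -
  let ?B = "plate k (- 1) 1 (- 4 * e) (4 * e)" and ?\<delta> = "8 * real CARD('n) * e\<^sup>2"
  have "emeasure lborel (knapp_region k e) = emeasure (lborel \<Otimes>\<^sub>M lborel) (knapp_region k e)"
    by (simp add: lborel_prod)
  also have "\<dots> = (\<integral>\<^sup>+ \<xi>. emeasure lborel ((\<lambda>t. (t, \<xi>)) -` knapp_region k e) \<partial>lborel)"
    using knapp_region_sets[of k e, folded borel_prod]
    by (intro lborel_pair.emeasure_pair_measure_alt2) auto
  also have "\<dots> \<le> (\<integral>\<^sup>+ \<xi>. ennreal (2 * ?\<delta>) * indicator ?B \<xi> \<partial>lborel)"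
  proof (intro nn_integral_mono)
    fix \<xi> :: "real ^ 'n"
    show "emeasure lborel ((\<lambda>t. (t, \<xi>)) -` knapp_region k e) \<le> ennreal (2 * ?\<delta>) * indicator ?B \<xi>"
    proof (cases "\<xi> \<in> ?B")
      case True
      have "emeasure lborel ((\<lambda>t. (t, \<xi>)) -` knapp_region k e) \<le> emeasure lborel {\<xi> $ k - ?\<delta> .. \<xi> $ k + ?\<delta>}"
        by (intro emeasure_mono) (auto simp: knapp_region_def abs_le_iff)
      also have "\<dots> = ennreal (2 * ?\<delta>)" by (subst emeasure_lborel_Icc) auto
      finally show ?thesis using True by simp
    next
      case False
      then have "(\<lambda>t. (t, \<xi>)) -` knapp_region k e = {}" by (auto simp: knapp_region_def)
      then show ?thesis by simp
    qed
  qed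
  also have "\<dots> = ennreal (2 * ?\<delta>) * ennreal (2 * (8 * e) ^ (CARD('n) - 1))"
    using e emeasure_plate[of "-1" 1 "- 4 * e" "4 * e" k] by (simp add: nn_integral_cmult_indicator)
  also have "\<dots> = ennreal (16 * real CARD('n) * e\<^sup>2 * (2 * (8 * e) ^ (CARD('n) - 1)))"
    using e by (subst ennreal_mult[symmetric]) auto
  finally show ?thesis .
qed

text \<open>The null form is a difference of nearly equal numbers. The second identity expresses it
  through the norm of one vector, which a single coordinate bounds from below.\<close>

lemma wave_pair_null_form:
  fixes \<eta> \<zeta> :: "'a::euclidean_space"
  shows "(norm (\<eta> - \<zeta>))\<^sup>2 - (norm \<eta> - norm \<zeta>)\<^sup>2 = 2 * (norm \<eta> * norm \<zeta> - \<eta> \<bullet> \<zeta>)"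
    and "(norm (norm \<eta> *\<^sub>R \<zeta> - norm \<zeta> *\<^sub>R \<eta>))\<^sup>2 = 2 * (norm \<eta> * norm \<zeta>) * (norm \<eta> * norm \<zeta> - \<eta> \<bullet> \<zeta>)"
proof -
  show "(norm (\<eta> - \<zeta>))\<^sup>2 - (norm \<eta> - norm \<zeta>)\<^sup>2 = 2 * (norm \<eta> * norm \<zeta> - \<eta> \<bullet> \<zeta>)"
    using dot_norm_neg[of \<eta> \<zeta>] by (simp add: power2_diff)
  have "norm \<eta> * norm \<zeta> * (\<zeta> \<bullet> \<eta>) = (2 * (norm \<eta> * norm \<zeta>)\<^sup>2 - (norm (norm \<eta> *\<^sub>R \<zeta> - norm \<zeta> *\<^sub>R \<eta>))\<^sup>2) / 2"
    using dot_norm_neg[of "norm \<eta> *\<^sub>R \<zeta>" "norm \<zeta> *\<^sub>R \<eta>"] by (simp add: mult_ac)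
  then show "(norm (norm \<eta> *\<^sub>R \<zeta> - norm \<zeta> *\<^sub>R \<eta>))\<^sup>2 = 2 * (norm \<eta> * norm \<zeta>) * (norm \<eta> * norm \<zeta> - \<eta> \<bullet> \<zeta>)"
    by (simp add: inner_commute[of \<zeta> \<eta>] right_diff_distrib power2_eq_square)
qed

text \<open>The gap between [0, e] and [3e, 4e] keeps the two vectors at an angle of order e. The
  factor 3 has to beat 5/2, the largest possible ratio of their norms.\<close>

lemma wave_pair_plates:
  fixes k :: "'n::finite"
  assumes n: "CARD('n) \<ge> 2" and e: "e > 0" "16 * real CARD('n) * e\<^sup>2 \<le> 1"
    and \<eta>: "\<eta> \<in> plate k 1 2 0 e" and \<zeta>: "\<zeta> \<in> plate k 1 2 (3 * e) (4 * e)"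
  shows "wave_pair (\<eta>, \<zeta>) \<in> knapp_region k e"
proof -
  define \<delta> where "\<delta> = 8 * real CARD('n) * e\<^sup>2"
  have \<delta>: "0 \<le> \<delta>" "\<delta> \<le> 1 / 2" using e by (auto simp: \<delta>_def)
  have e': "0 \<le> e" "e \<le> 4 * e" "0 \<le> 3 * e" using e by auto
  have "\<eta> \<in> plate k 1 2 0 (4 * e)" "\<zeta> \<in> plate k 1 2 0 (4 * e)"
    using \<eta> \<zeta> e' by (auto simp: plate_def intro: order_trans)
  then have N: "\<eta> $ k \<le> norm \<eta>" "norm \<eta> \<le> \<eta> $ k + \<delta>" "\<zeta> $ k \<le> norm \<zeta>" "norm \<zeta> \<le> \<zeta> $ k + \<delta>"
    using norm_plate unfolding \<delta>_def by blast+
  have K: "1 \<le> \<eta> $ k" "\<eta> $ k \<le> 2" "1 \<le> \<zeta> $ k" "\<zeta> $ k \<le> 2" using \<eta> \<zeta> by (auto simp: plate_def)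
  have n52: "norm \<eta> \<le> 5 / 2" "norm \<zeta> \<le> 5 / 2" "1 \<le> norm \<eta>" "1 \<le> norm \<zeta>" using N K \<delta> by auto
  let ?G = "norm \<eta> * norm \<zeta> - \<eta> \<bullet> \<zeta>"
  have G0: "0 \<le> ?G" using norm_cauchy_schwarz[of \<eta> \<zeta>] by simp
  have upper: "?G \<le> 36 * real CARD('n) * e\<^sup>2"
  proof -
    have "\<eta> $ k * \<zeta> $ k \<le> (\<Sum>i\<in>UNIV. \<eta> $ i * \<zeta> $ i)"
    proof (rule member_le_sum)
      fix i assume "i \<in> UNIV - {k}"
      then have "0 \<le> \<eta> $ i" "3 * e \<le> \<zeta> $ i" using \<eta> \<zeta> by (auto simp: plate_def)
      then show "0 \<le> \<eta> $ i * \<zeta> $ i" using e by auto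
    qed auto
    then have 1: "\<eta> $ k * \<zeta> $ k \<le> \<eta> \<bullet> \<zeta>" by (simp add: inner_vec_def)
    have "norm \<eta> * norm \<zeta> \<le> (\<eta> $ k + \<delta>) * (\<zeta> $ k + \<delta>)" using N K \<delta> by (intro mult_mono) auto
    also have "\<dots> = \<eta> $ k * \<zeta> $ k + \<delta> * (\<eta> $ k + \<zeta> $ k + \<delta>)" by (simp add: algebra_simps)
    \<comment> \<open>Here 9/2 = 2 + 2 + 1/2, and 8 * 9/2 = 36.\<close>
    also have "\<delta> * (\<eta> $ k + \<zeta> $ k + \<delta>) \<le> \<delta> * (9 / 2)" using K \<delta> by (intro mult_left_mono) auto
    finally show ?thesis using 1 by (simp add: \<delta>_def)
  qed
  have lower: "e\<^sup>2 / 25 \<le> 2 * ?G"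
  proof -
    obtain j where j: "j \<noteq> k"
    proof -
      have "UNIV \<noteq> {k}"
      proof
        assume "UNIV = {k}"
        then have "CARD('n) = card {k}" by (rule arg_cong)
        then show False using n by simp
      qed
      then show ?thesis using that by blast
    qed
    let ?v = "norm \<eta> *\<^sub>R \<zeta> - norm \<zeta> *\<^sub>R \<eta>"
    have J: "0 \<le> \<eta> $ j" "\<eta> $ j \<le> e" "3 * e \<le> \<zeta> $ j" using j \<eta> \<zeta> by (auto simp: plate_def)
    \<comment> \<open>Coordinate j of \<open>?v\<close> is at least 3e - (5/2) e = e / 2.\<close>
    have "1 * (3 * e) \<le> norm \<eta> * \<zeta> $ j" using n52 J e by (intro mult_mono) auto
    moreover have "norm \<zeta> * \<eta> $ j \<le> 5 / 2 * e" using n52 J e by (intro mult_mono) auto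
    ultimately have "e / 2 \<le> ?v $ j" by simp
    also have "\<dots> \<le> norm ?v" using component_le_norm_cart[of ?v j] by linarith
    finally have "(e / 2)\<^sup>2 \<le> (norm ?v)\<^sup>2" using e by (intro power_mono) auto
    also have "\<dots> = 2 * ?G * (norm \<eta> * norm \<zeta>)" by (simp add: wave_pair_null_form(2))
    \<comment> \<open>Dividing (e/2)^2 by (5/2)^2 gives the constant 1/25.\<close>
    also have "\<dots> \<le> 2 * ?G * (5 / 2 * (5 / 2))" using G0 n52 by (intro mult_left_mono mult_mono) auto
    finally show ?thesis by (simp add: power2_eq_square)
  qed
  have "\<bar>(norm \<eta> - norm \<zeta>) - (\<eta> - \<zeta>) $ k\<bar> \<le> \<delta>" using N by (simp add: abs_le_iff)
  moreover have "\<eta> - \<zeta> \<in> plate k (- 1) 1 (- 4 * e) (4 * e)"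
  proof -
    have "- 4 * e \<le> \<eta> $ j - \<zeta> $ j \<and> \<eta> $ j - \<zeta> $ j \<le> 4 * e" if "j \<noteq> k" for j
    proof -
      have "0 \<le> \<eta> $ j" "\<eta> $ j \<le> e" "3 * e \<le> \<zeta> $ j" "\<zeta> $ j \<le> 4 * e" using \<eta> \<zeta> that by (auto simp: plate_def)
      then show ?thesis using e by auto
    qed
    then show ?thesis using K by (auto simp: plate_def)
  qed
  moreover have "\<bar>(norm \<eta> - norm \<zeta>)\<^sup>2 - (norm (\<eta> - \<zeta>))\<^sup>2\<bar> = 2 * ?G"
    using wave_pair_null_form(1)[of \<eta> \<zeta>] G0 by simp
  ultimately show ?thesis
    using upper lower by (simp add: knapp_region_def wave_pair_def \<delta>_def)
qed

section \<open>Norms of the plate packet\<close>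

lemma esqrt_ennreal: "x \<ge> 0 \<Longrightarrow> esqrt (ennreal x) = ennreal (sqrt x)"
  by (simp add: esqrt_def)

text \<open>Since 1 <= |xi| <= 5/2 on the plate, the weight lies between constants depending only on
  s, and the squared norm h is comparable to the volume. Positivity of h excludes a quotient that is
  large merely through division by zero.\<close>

lemma Hdot_norm_wave_packet_plate:
  fixes k :: "'n::finite" and s :: real
  defines "L \<equiv> max 1 ((5 / 2) powr (2 * s))"
  assumes e: "e > 0" "16 * real CARD('n) * e\<^sup>2 \<le> 1"
  obtains h where "h > 0" "h \<le> (2 * pi) powr - real CARD('n) * (L * (4 * e) ^ (CARD('n) - 1))"
    "Hdot_norm s (wave_packet (plate k 1 2 0 (4 * e))) = ennreal (sqrt h)"
proof -
  let ?P = "plate k 1 2 0 (4 * e)"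
  define v where "v = (4 * e) ^ (CARD('n) - 1)"
  define l where "l = min 1 ((5 / 2 :: real) powr (2 * s))"
  have vol: "emeasure lborel ?P = ennreal v" using e emeasure_plate[of 1 2 0 "4 * e" k] by (simp add: v_def)
  have fin: "emeasure lborel ?P < \<infinity>" by (simp add: vol)
  have v: "v > 0" using e by (simp add: v_def)
  have l: "l > 0" by (simp add: l_def)
  define I where "I = (\<integral>\<^sup>+ \<xi>. ennreal (norm \<xi> powr (2 * s) * (cmod (fourier (wave_packet ?P) \<xi>))\<^sup>2) \<partial>lborel)"
  have I: "I = (\<integral>\<^sup>+ \<xi>. ennreal (norm \<xi> powr (2 * s)) * indicator ?P \<xi> \<partial>lborel)"
    unfolding I_def
  proof (rule nn_integral_cong_AE)
    show "AE \<xi> in lborel. ennreal (norm \<xi> powr (2 * s) * (cmod (fourier (wave_packet ?P) \<xi>))\<^sup>2)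
        = ennreal (norm \<xi> powr (2 * s)) * indicator ?P \<xi>"
      using AE_fourier_wave_packet[OF plate_sets fin] by eventually_elim (simp add: indicator_def)
  qed
  have bd: "l \<le> norm \<xi> powr (2 * s)" "norm \<xi> powr (2 * s) \<le> L" if "\<xi> \<in> ?P" for \<xi>
  proof -
    have "1 \<le> norm \<xi>" "norm \<xi> \<le> 5 / 2"
      using norm_plate[OF that] that e by (auto simp: plate_def)
    from powr_between[OF _ this, of "2 * s"]
    show "l \<le> norm \<xi> powr (2 * s)" "norm \<xi> powr (2 * s) \<le> L" by (simp_all add: l_def L_def)
  qed
  have "I \<le> (\<integral>\<^sup>+ \<xi>. ennreal L * indicator ?P \<xi> \<partial>lborel)"
    unfolding I using bd by (intro nn_integral_mono) (auto simp: indicator_def intro: ennreal_leI)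
  also have "\<dots> = ennreal (L * v)"
    using v by (simp add: nn_integral_cmult_indicator vol ennreal_mult L_def)
  finally have I_le: "I \<le> ennreal (L * v)" .
  have "ennreal (l * v) = (\<integral>\<^sup>+ \<xi>. ennreal l * indicator ?P \<xi> \<partial>lborel)"
    using v l by (simp add: nn_integral_cmult_indicator vol ennreal_mult)
  also have "\<dots> \<le> I"
    unfolding I using bd by (intro nn_integral_mono) (auto simp: indicator_def intro: ennreal_leI)
  finally have I_ge: "ennreal (l * v) \<le> I" .
  have "I < top" using I_le by (rule le_less_trans) simp
  then obtain i where i: "I = ennreal i" "i \<ge> 0" by (cases I) auto
  have Lv: "0 \<le> L * v" using v by (simp add: L_def)
  have "l * v \<le> i" "i \<le> L * v" using I_ge I_le i Lv by (simp_all add: ennreal_le_iff)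
  moreover have "0 < l * v" using l v by simp
  ultimately have i': "0 < i" "i \<le> L * v" by auto
  let ?c = "(2 * pi) powr - real CARD('n)"
  have "Hdot_norm s (wave_packet ?P) = esqrt (ennreal ?c * I)"
    by (simp add: Hdot_norm_def I_def)
  also have "\<dots> = ennreal (sqrt (?c * i))"
    using i by (simp add: ennreal_mult[symmetric] esqrt_ennreal)
  finally have "Hdot_norm s (wave_packet ?P) = ennreal (sqrt (?c * i))" .
  then show ?thesis using i' that[of "?c * i"] by (simp add: v_def mult_left_mono)
qed

text \<open>X is the squared norm before normalisation and may be infinite, so the estimate stays in
  product form. On the right, \<open>B * e powr (- 4 * \<beta>)\<close> bounds the inverse squared
  weight on the region and the rest is the volume bound.\<close>

lemma box_power_norm_packet_density_plate:
  fixes k :: "'n::finite" and \<beta> :: real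
  defines "K \<equiv> (2 * pi) ^ (CARD('n) + 1) * ((2 * pi) powr - real CARD('n))\<^sup>2"
    and "B \<equiv> max ((1 / 25) powr (- 2 * \<beta>)) ((72 * real CARD('n)) powr (- 2 * \<beta>))"
  assumes n: "CARD('n) \<ge> 2" and e: "e > 0" "16 * real CARD('n) * e\<^sup>2 \<le> 1"
  obtains X where
    "box_power_norm \<beta> (packet_density (plate k 1 2 0 (4 * e))) = esqrt (ennreal ((2 * pi) powr - (real CARD('n) + 1)) * X)"
    "ennreal ((K * (e ^ (CARD('n) - 1))\<^sup>2)\<^sup>2)
      \<le> X * ennreal (B * e powr (- 4 * \<beta>) * (16 * real CARD('n) * e\<^sup>2 * (2 * (8 * e) ^ (CARD('n) - 1))))"
proof -
  let ?P = "plate k 1 2 0 (4 * e)" and ?E = "knapp_region k e"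
  let ?q = "\<lambda>p :: real \<times> (real ^ 'n). \<bar>(fst p)\<^sup>2 - (norm (snd p))\<^sup>2\<bar>"
  have K: "K > 0" by (simp add: K_def)
  have fin: "emeasure lborel ?P < \<infinity>" using e emeasure_plate[of 1 2 0 "4 * e" k] by simp
  have dim: "DIM(real ^ 'n) \<ge> 2" using n by simp
  obtain D where D[measurable]: "D \<in> borel_measurable borel" and D0: "\<And>p. D p \<ge> 0"
    and FD: "AE p in lborel. fourier (packet_density ?P) p = of_real (K * D p)"
    and DE: "\<And>E. E \<in> sets borel \<Longrightarrow>
       (\<integral>\<^sup>+ p. ennreal (D p) * indicator E p \<partial>lborel) = emeasure lborel (?P \<times> ?P \<inter> wave_pair -` E)"
    using fourier_packet_density[OF plate_sets fin dim] unfolding K_def by auto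
  define X where "X = (\<integral>\<^sup>+ p. ennreal ((?q p powr \<beta> * (K * D p))\<^sup>2) \<partial>lborel)"
  have "(\<integral>\<^sup>+ (\<tau>, \<xi>). ennreal ((\<bar>\<tau>\<^sup>2 - (norm \<xi>)\<^sup>2\<bar> powr \<beta> * cmod (fourier (packet_density ?P) (\<tau>, \<xi>)))\<^sup>2) \<partial>lborel) = X"
    unfolding X_def
  proof (rule nn_integral_cong_AE)
    show "AE p in lborel. (case p of (\<tau>, \<xi>) \<Rightarrow>
        ennreal ((\<bar>\<tau>\<^sup>2 - (norm \<xi>)\<^sup>2\<bar> powr \<beta> * cmod (fourier (packet_density ?P) (\<tau>, \<xi>)))\<^sup>2))
        = ennreal ((?q p powr \<beta> * (K * D p))\<^sup>2)"
      using FD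
    proof eventually_elim
      case (elim p)
      have "cmod (fourier (packet_density ?P) p) = K * D p"
        unfolding elim norm_of_real using K D0[of p] by simp
      then show ?case by (cases p) simp
    qed
  qed
  then have box: "box_power_norm \<beta> (packet_density ?P) = esqrt (ennreal ((2 * pi) powr - (real CARD('n) + 1)) * X)"
    by (simp add: box_power_norm_def)
  let ?Pa = "plate k 1 2 0 e" and ?Pb = "plate k 1 2 (3 * e) (4 * e)"
  define m where "m = CARD('n) - 1"
  \<comment> \<open>Pairs from the two subplates all land in the region and already carry a fixed
    proportion of the mass of \<open>?P \<times> ?P\<close>.\<close>
  have "ennreal ((e ^ m)\<^sup>2) = emeasure lborel ?Pa * emeasure lborel ?Pb"
    using e emeasure_plate[of 1 2 0 e k] emeasure_plate[of 1 2 "3 * e" "4 * e" k]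
    by (simp add: ennreal_mult[symmetric] power2_eq_square m_def)
  also have "\<dots> = emeasure lborel (?Pa \<times> ?Pb)"
    using lborel.emeasure_pair_measure_Times[of ?Pa lborel ?Pb] by (simp add: lborel_prod)
  also have "\<dots> \<le> emeasure lborel (?P \<times> ?P \<inter> wave_pair -` ?E)"
  proof (rule emeasure_mono)
    have "?Pa \<subseteq> ?P" "?Pb \<subseteq> ?P" using e by (force simp: plate_def)+
    then show "?Pa \<times> ?Pb \<subseteq> ?P \<times> ?P \<inter> wave_pair -` ?E"
      using wave_pair_plates[OF n e] by auto
    have "?P \<times> ?P \<in> sets borel" by (intro borel_Times) auto
    moreover have "wave_pair -` ?E \<in> sets borel"
      using measurable_sets[OF wave_pair_measurable knapp_region_sets] by simp
    ultimately show "?P \<times> ?P \<inter> wave_pair -` ?E \<in> sets lborel" by simp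
  qed
  also have "\<dots> = (\<integral>\<^sup>+ p. ennreal (D p) * indicator ?E p \<partial>lborel)"
    by (rule DE[OF knapp_region_sets, symmetric])
  finally have mass: "ennreal ((e ^ m)\<^sup>2) \<le> (\<integral>\<^sup>+ p. ennreal (D p) * indicator ?E p \<partial>lborel)" .
  have "ennreal (K * (e ^ m)\<^sup>2) = ennreal K * ennreal ((e ^ m)\<^sup>2)" using K by (simp add: ennreal_mult)
  also have "\<dots> \<le> ennreal K * (\<integral>\<^sup>+ p. ennreal (D p) * indicator ?E p \<partial>lborel)"
    using mass by (rule mult_left_mono) simp
  also have "\<dots> = (\<integral>\<^sup>+ p. ennreal (K * D p) * indicator ?E p \<partial>lborel)"
    using K D0 knapp_region_sets[of k e]
    by (subst nn_integral_cmult[symmetric]) (auto simp: ennreal_mult mult.assoc)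
  finally have "(ennreal (K * (e ^ m)\<^sup>2))\<^sup>2 \<le> (\<integral>\<^sup>+ p. ennreal (K * D p) * indicator ?E p \<partial>lborel)\<^sup>2"
    by (rule power_mono) simp
  also have "\<dots> \<le> X * (ennreal (max ((e\<^sup>2 / 25) powr (- 2 * \<beta>)) ((72 * real CARD('n) * e\<^sup>2) powr (- 2 * \<beta>))) * emeasure lborel ?E)"
    unfolding X_def
  proof (rule weighted_Cauchy_Schwarz)
    show "?q \<in> borel_measurable lborel"
      unfolding lborel_def[symmetric] by (simp add: borel_measurable_continuous_onI continuous_intros)
    show "?E \<in> sets lborel" using knapp_region_sets by simp
    show "e\<^sup>2 / 25 \<le> ?q p \<and> ?q p \<le> 72 * real CARD('n) * e\<^sup>2" if "p \<in> ?E" for p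
      using that by (simp add: knapp_region_def)
  qed (use e K D0 in auto)
  \<comment> \<open>Both bounds on the null form scale like e^2, so the factor (e^2)^(-2 beta) comes
    out of the maximum.\<close>
  also have "max ((e\<^sup>2 / 25) powr (- 2 * \<beta>)) ((72 * real CARD('n) * e\<^sup>2) powr (- 2 * \<beta>)) = B * e powr (- 4 * \<beta>)"
  proof -
    have "(e\<^sup>2) powr (- 2 * \<beta>) = e powr (- 4 * \<beta>)"
      using e by (simp add: powr_powr flip: powr_numeral)
    moreover have "(e\<^sup>2 / 25) powr (- 2 * \<beta>) = (1 / 25) powr (- 2 * \<beta>) * (e\<^sup>2) powr (- 2 * \<beta>)"
      using powr_mult[of "1 / 25" "e\<^sup>2" "- 2 * \<beta>"] by simp
    moreover have "(72 * real CARD('n) * e\<^sup>2) powr (- 2 * \<beta>) = (72 * real CARD('n)) powr (- 2 * \<beta>) * (e\<^sup>2) powr (- 2 * \<beta>)"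
      by (rule powr_mult)
    ultimately show ?thesis by (simp add: B_def max_mult_distrib_right)
  qed
  also have "X * (ennreal (B * e powr (- 4 * \<beta>)) * emeasure lborel ?E)
      \<le> X * (ennreal (B * e powr (- 4 * \<beta>)) * ennreal (16 * real CARD('n) * e\<^sup>2 * (2 * (8 * e) ^ m)))"
    using emeasure_knapp_region[OF e(1), of k] unfolding m_def by (intro mult_left_mono) auto
  also have "\<dots> = X * ennreal (B * e powr (- 4 * \<beta>) * (16 * real CARD('n) * e\<^sup>2 * (2 * (8 * e) ^ m)))"
    using e by (subst ennreal_mult[symmetric]) (auto simp: B_def le_max_iff_disj)
  finally have "(ennreal (K * (e ^ m)\<^sup>2))\<^sup>2 \<le> X * ennreal (B * e powr (- 4 * \<beta>) * (16 * real CARD('n) * e\<^sup>2 * (2 * (8 * e) ^ m)))" .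
  then have "ennreal ((K * (e ^ m)\<^sup>2)\<^sup>2) \<le> X * ennreal (B * e powr (- 4 * \<beta>) * (16 * real CARD('n) * e\<^sup>2 * (2 * (8 * e) ^ m)))"
    using K e by (simp add: ennreal_power)
  then show ?thesis using that[OF box] by (simp only: m_def)
qed

theorem proposition3:
  fixes \<beta> A :: real
  assumes "CARD('n::finite) \<ge> 2"
    and "\<beta> < (3 - real CARD('n)) / 4"
    and "A > 0"
  shows "\<exists>f :: real ^ 'n \<Rightarrow> complex.
           f \<in> Hdot ((real CARD('n) - 1) / 4 + \<beta>) \<and>
           Hdot_norm ((real CARD('n) - 1) / 4 + \<beta>) f > 0 \<and>
           box_power_norm \<beta> (\<lambda>p. of_real ((cmod (halfwave f p))\<^sup>2))
             / (Hdot_norm ((real CARD('n) - 1) / 4 + \<beta>) f)\<^sup>2 > ennreal A"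
proof -
  define n where "n = CARD('n)"
  define m where "m = n - 1"
  define s where "s = (real n - 1) / 4 + \<beta>"
  \<comment> \<open>The exponent of e in the squared quotient: 4 m from the squared mass, minus m +
    2 - 4 beta from volume and weight, minus 2 m from the square of h. The hypothesis on
    \<open>\<beta>\<close> says exactly that it is negative.\<close>
  define \<gamma> where "\<gamma> = real m - 2 + 4 * \<beta>"
  have n: "n \<ge> 2" and nm: "real n = real m + 1" using assms(1) by (auto simp: n_def m_def)
  have \<gamma>: "\<gamma> < 0" using assms(2) nm by (simp add: \<gamma>_def n_def field_simps)
  define K where "K = (2 * pi) ^ (n + 1) * ((2 * pi) powr - real n)\<^sup>2"
  define B where "B = max ((1 / 25) powr (- 2 * \<beta>)) ((72 * real n) powr (- 2 * \<beta>))"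
  define L where "L = max 1 ((5 / 2) powr (2 * s))"
  define c1 where "c1 = (2 * pi) powr - real n"
  define c2 where "c2 = (2 * pi) powr - (real n + 1)"
  define V where "V = B * (16 * real n * (2 * 8 ^ m))"
  have pos: "K > 0" "B > 0" "L > 0" "c1 > 0" "c2 > 0"
    by (auto simp: K_def B_def L_def c1_def c2_def less_max_iff_disj)
  have V: "V > 0" using pos n by (simp add: V_def)
  \<comment> \<open>The threshold: once h is replaced by its upper bound, the inequality
    \<open>key\<close> amounts to \<open>G < e powr \<gamma>\<close>.\<close>
  define G where "G = (A * c1 * L * 4 ^ m)\<^sup>2 * V / (c2 * K\<^sup>2)"
  have G: "G \<ge> 0" using V pos by (simp add: G_def)
  \<comment> \<open>The first entry yields 16 n e^2 <= 1. The second yields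
    \<open>e powr \<gamma> \<ge> G + 1\<close>, as the power decreases in e; the added 1 gives
    strictness and a positive base.\<close>
  define e where "e = min (1 / (4 * real n)) ((G + 1) powr (1 / \<gamma>))"
  have e: "e > 0" "e \<le> 1 / (4 * real n)" using n G by (auto simp: e_def)
  have e16: "16 * real n * e\<^sup>2 \<le> 1"
  proof -
    have "e\<^sup>2 \<le> (1 / (4 * real n))\<^sup>2" using e by (intro power_mono) auto
    then have "16 * real n * e\<^sup>2 \<le> 16 * real n * (1 / (4 * real n))\<^sup>2" by (intro mult_left_mono) auto
    also have "\<dots> = 1 / real n" using n by (simp add: power2_eq_square)
    also have "\<dots> \<le> 1" using n by simp
    finally show ?thesis .
  qed
  have eG: "G < e powr \<gamma>"
  proof -
    have "((G + 1) powr (1 / \<gamma>)) powr \<gamma> \<le> e powr \<gamma>"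
      using e(1) \<gamma> by (intro powr_mono2') (auto simp: e_def)
    then show ?thesis using \<gamma> G by (simp add: powr_powr)
  qed
  obtain k :: 'n where True by simp
  let ?P = "plate k 1 2 0 (4 * e)"
  have fin: "emeasure lborel ?P < \<infinity>" using e emeasure_plate[of 1 2 0 "4 * e" k] by simp
  obtain h where h: "h > 0" "h \<le> c1 * (L * (4 * e) ^ m)" "Hdot_norm s (wave_packet ?P) = ennreal (sqrt h)"
    using Hdot_norm_wave_packet_plate[OF e(1), where k=k and s=s] e16
    unfolding n_def m_def L_def c1_def by blast
  obtain X where X: "box_power_norm \<beta> (packet_density ?P) = esqrt (ennreal c2 * X)"
    "ennreal ((K * (e ^ m)\<^sup>2)\<^sup>2) \<le> X * ennreal (B * e powr (- 4 * \<beta>) * (16 * real n * e\<^sup>2 * (2 * (8 * e) ^ m)))"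
    using box_power_norm_packet_density_plate[OF assms(1) e(1), where k=k and \<beta>=\<beta>] e16
    unfolding n_def m_def K_def B_def c2_def by blast
  define v where "v = B * e powr (- 4 * \<beta>) * (16 * real n * e\<^sup>2 * (2 * (8 * e) ^ m))"
  have v: "v = V * e powr (real m + 2 - 4 * \<beta>)"
  proof -
    have "e powr (real m + 2 - 4 * \<beta>) = e powr real (m + 2) * e powr (- 4 * \<beta>)"
      unfolding powr_add[symmetric] by (rule arg_cong) simp
    also have "e powr real (m + 2) = e ^ m * e\<^sup>2" using e(1) by (simp only: powr_realpow power_add)
    finally show ?thesis by (simp add: v_def V_def power_mult_distrib)
  qed
  have v0: "v > 0" unfolding v using V e by simp
  have key: "(A * h)\<^sup>2 * v < c2 * (K * (e ^ m)\<^sup>2)\<^sup>2"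
  proof -
    have em: "e powr \<gamma> * e powr (real m + 2 - 4 * \<beta>) = (e ^ m)\<^sup>2"
    proof -
      have "e powr \<gamma> * e powr (real m + 2 - 4 * \<beta>) = e powr real (m * 2)"
        unfolding powr_add[symmetric] \<gamma>_def by (rule arg_cong) simp
      also have "\<dots> = e ^ (m * 2)" using e(1) by (rule powr_realpow)
      finally show ?thesis by (simp only: power_mult)
    qed
    have "(A * h)\<^sup>2 * v \<le> (A * (c1 * (L * (4 * e) ^ m)))\<^sup>2 * v"
      using h v0 assms(3) by (intro mult_right_mono power_mono mult_left_mono) auto
    also have "\<dots> = c2 * K\<^sup>2 * (G * (e powr (real m + 2 - 4 * \<beta>) * (e ^ m)\<^sup>2))"
      using pos unfolding v by (simp add: G_def power_mult_distrib)
    also have "\<dots> < c2 * K\<^sup>2 * (e powr \<gamma> * (e powr (real m + 2 - 4 * \<beta>) * (e ^ m)\<^sup>2))"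
      using eG e(1) pos by (intro mult_strict_left_mono mult_strict_right_mono) auto
    also have "e powr \<gamma> * (e powr (real m + 2 - 4 * \<beta>) * (e ^ m)\<^sup>2) = (e ^ m)\<^sup>2 * (e ^ m)\<^sup>2"
      by (simp only: mult.assoc[symmetric] em)
    also have "c2 * K\<^sup>2 * ((e ^ m)\<^sup>2 * (e ^ m)\<^sup>2) = c2 * (K * (e ^ m)\<^sup>2)\<^sup>2"
      by (simp add: power2_eq_square mult_ac)
    finally show ?thesis .
  qed
  have "ennreal A < esqrt (ennreal c2 * X) / ennreal h"
  \<comment> \<open>An infinite X makes the quotient infinite because h is finite; a finite X is
    handled by \<open>key\<close>.\<close>
  proof (cases X)
    case top
    then show ?thesis using pos h by (simp add: ennreal_mult_top esqrt_def ennreal_top_divide)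
  next
    case (real x)
    have "(K * (e ^ m)\<^sup>2)\<^sup>2 \<le> x * v"
      using X(2) real v0 unfolding v_def[symmetric] by (simp add: ennreal_mult[symmetric] ennreal_le_iff)
    then have "c2 * (K * (e ^ m)\<^sup>2)\<^sup>2 \<le> c2 * x * v" using pos by (simp add: mult.assoc)
    then have "(A * h)\<^sup>2 * v < c2 * x * v" using key by simp
    then have "(A * h)\<^sup>2 < c2 * x" using v0 by simp
    then have "A * h < sqrt (c2 * x)" by (rule real_less_rsqrt)
    then have "A < sqrt (c2 * x) / h" using h by (simp add: pos_less_divide_eq)
    moreover have "esqrt (ennreal c2 * X) = ennreal (sqrt (c2 * x))"
      using real pos by (simp add: ennreal_mult[symmetric] esqrt_ennreal)
    ultimately show ?thesis
      using h real pos assms(3) by (simp add: divide_ennreal ennreal_less_iff)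
  qed
  moreover have "(Hdot_norm s (wave_packet ?P))\<^sup>2 = ennreal h" using h by (simp add: ennreal_power)
  ultimately have "box_power_norm \<beta> (packet_density ?P) / (Hdot_norm s (wave_packet ?P))\<^sup>2 > ennreal A"
    using X(1) by simp
  moreover have "wave_packet ?P \<in> Hdot s" "Hdot_norm s (wave_packet ?P) > 0"
    using h fourier_wave_packet[OF plate_sets fin] by (auto simp: Hdot_def)
  ultimately show ?thesis
    unfolding packet_density_def s_def n_def by blast
qed

end
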